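(* For every positive integer $b$ there exists $N = N(b)$ such that for all integers $n \geq N$ the polynomial $F_{\lambda_{n,b}}(q) = \sum_{\ell \geq 0} c_{n,b}(\ell)\, q^\ell$ is unimodal, i.e. there is an index $k$ with $c_{n,b}(0) \leq c_{n,b}(1) \leq \cdots \leq c_{n,b}(k) \geq c_{n,b}(k+1) \geq c_{n,b}(k+2) \geq \cdots$.
   Context: For positive integers $n, b$, let $\lambda_{n,b} := (n, n-1, \ldots, n-b+1)$ (a truncated staircase). For an integer $\ell \geq 0$, let $c_{n,b}(\ell)$ be the number of partitions of $\ell$ into distinct parts whose Young diagrams fit inside $\lambda_{n,b}$, i.e. the number of sequences of integers $\lambda_1 > \lambda_2 > \cdots > \lambda_r > 0$ with $0 \leq r \leq b$, $\lambda_1 \leq n$ and $\sum_i \lambda_i = \ell$. The rank-generating function is $F_{\lambda_{n,b}}(q) := \sum_{\ell \geq 0} c_{n,b}(\ell) q^\ell$ (a polynomial). A polynomial is called unimodal if its sequence of coefficients, in increasing order of degree, weakly increases and then weakly decreases. *)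

theory Defs
  imports "HOL-Computational_Algebra.Polynomial" "HOL-Library.Groups_Big_Fun"
begin

text \<open>
  A sequence of row lengths is a list; rows and columns of its diagram are counted from 0.
  Rows of length 0 contribute no cells.
\<close>

definition young_diagram :: "nat list \<Rightarrow> (nat \<times> nat) set" where
  "young_diagram xs = {(i, j). i < length xs \<and> j < xs ! i}"

definition distinct_partition :: "nat list \<Rightarrow> bool" where
  "distinct_partition xs \<longleftrightarrow> sorted_wrt (>) xs \<and> (\<forall>x\<in>set xs. 0 < x)"

definition partitions_inside :: "nat list \<Rightarrow> nat list set" where
  "partitions_inside \<mu> = {xs. distinct_partition xs \<and> young_diagram xs \<subseteq> young_diagram \<mu>}"

definition num_partitions_inside :: "nat list \<Rightarrow> nat \<Rightarrow> nat" where
  "num_partitions_inside \<mu> l = card {xs \<in> partitions_inside \<mu>. sum_list xs = l}"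

text \<open>
  The sum ranges over all natural numbers; it has finite support by
  \<open>finite_support\<close> below, and \<open>coeff_rank_gen_poly\<close> confirms its coefficients.
\<close>

definition rank_gen_poly :: "nat list \<Rightarrow> nat poly" where
  "rank_gen_poly \<mu> = Sum_any (\<lambda>l. monom (num_partitions_inside \<mu> l) l)"

text \<open>
  The list $(n, n-1, \ldots, n-b+1)$. For $b > n$ the truncated subtraction
  makes the surplus rows empty.
\<close>

definition truncated_staircase :: "nat \<Rightarrow> nat \<Rightarrow> nat list" where
  "truncated_staircase n b = map (\<lambda>i. n - i) [0..<b]"

text \<open>
  The coefficients are natural numbers, so the zeros beyond the degree
  do not affect unimodality.
\<close>

definition unimodal :: "nat poly \<Rightarrow> bool" where
  "unimodal p \<longleftrightarrow>
     (\<exists>k. (\<forall>i<k. coeff p i \<le> coeff p (Suc i)) \<and> (\<forall>i\<ge>k. coeff p (Suc i) \<le> coeff p i))"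

lemma young_diagram_Sigma: "young_diagram xs = Sigma {..<length xs} (\<lambda>i. {..<xs ! i})"
  by (auto simp: young_diagram_def)

lemma finite_young_diagram: "finite (young_diagram xs)"
  by (simp add: young_diagram_Sigma)

lemma card_young_diagram: "card (young_diagram xs) = sum_list xs"
  by (simp add: young_diagram_Sigma sum_list_sum_nth atLeast0LessThan)

lemma partitions_inside_iff:
  "xs \<in> partitions_inside \<mu> \<longleftrightarrow>
     distinct_partition xs \<and> length xs \<le> length \<mu> \<and> (\<forall>i<length xs. xs ! i \<le> \<mu> ! i)"
proof (intro iffI)
  assume "xs \<in> partitions_inside \<mu>"
  then have d: "distinct_partition xs" and s: "young_diagram xs \<subseteq> young_diagram \<mu>"
    by (auto simp: partitions_inside_def)
  have row: "i < length \<mu> \<and> xs ! i \<le> \<mu> ! i" if i: "i < length xs" for i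
  proof -
    have "0 < xs ! i"
      using d i by (auto simp: distinct_partition_def)
    then have "(i, xs ! i - 1) \<in> young_diagram xs"
      using i by (simp add: young_diagram_def)
    then have "(i, xs ! i - 1) \<in> young_diagram \<mu>"
      using s by blast
    then show ?thesis
      by (auto simp: young_diagram_def)
  qed
  have "length xs \<le> length \<mu>"
    using row[of "length \<mu>"] by (cases "length xs \<le> length \<mu>") auto
  with d row show "distinct_partition xs \<and> length xs \<le> length \<mu> \<and> (\<forall>i<length xs. xs ! i \<le> \<mu> ! i)"
    by blast
qed (fastforce simp: partitions_inside_def young_diagram_def)

lemma finite_partitions_inside: "finite (partitions_inside \<mu>)"
proof (rule finite_subset)
  show "partitions_inside \<mu> \<subseteq> {xs. set xs \<subseteq> {..sum_list \<mu>} \<and> length xs \<le> length \<mu>}"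
  proof
    fix xs assume xs: "xs \<in> partitions_inside \<mu>"
    have "sum_list xs \<le> sum_list \<mu>"
      using xs card_mono[OF finite_young_diagram[of \<mu>], of "young_diagram xs"]
      by (simp add: partitions_inside_def card_young_diagram)
    then have "set xs \<subseteq> {..sum_list \<mu>}"
      using member_le_sum_list order_trans by fastforce
    then show "xs \<in> {xs. set xs \<subseteq> {..sum_list \<mu>} \<and> length xs \<le> length \<mu>}"
      using xs by (simp add: partitions_inside_iff)
  qed
qed (simp add: finite_lists_length_le)

lemma finite_support: "finite {l. num_partitions_inside \<mu> l \<noteq> 0}"
proof (rule finite_subset)
  show "{l. num_partitions_inside \<mu> l \<noteq> 0} \<subseteq> sum_list ` partitions_inside \<mu>"
    by (auto simp: num_partitions_inside_def card_gt_0_iff)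
qed (simp add: finite_partitions_inside)

lemma coeff_rank_gen_poly: "coeff (rank_gen_poly \<mu>) l = num_partitions_inside \<mu> l"
  using finite_support[of \<mu>]
  by (simp add: rank_gen_poly_def Sum_any.expand_set coeff_sum monom_eq_0_iff)

lemma partitions_inside_truncated_staircase:
  "partitions_inside (truncated_staircase n b) =
     {xs. sorted_wrt (>) xs \<and> (\<forall>x\<in>set xs. 0 < x \<and> x \<le> n) \<and> length xs \<le> b}"
proof -
  have gap: "xs ! i + i \<le> n"
    if "sorted_wrt (>) xs" "\<forall>x\<in>set xs. x \<le> n" "i < length xs" for xs i
    using that(3)
  proof (induction i)
    case 0
    then show ?case using that(2) by simp
  next
    case (Suc i)
    then have "xs ! Suc i < xs ! i"
      using that(1) by (auto simp: sorted_wrt_iff_nth_less)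
    with Suc show ?case by simp
  qed
  have "(\<forall>i<length xs. xs ! i \<le> n - i) \<longleftrightarrow> (\<forall>x\<in>set xs. x \<le> n)" if "sorted_wrt (>) xs" for xs
    using gap[OF that] by (fastforce simp: in_set_conv_nth)
  then show ?thesis
    by (auto simp: partitions_inside_iff truncated_staircase_def distinct_partition_def)
qed

end

theory Submission
  imports Defs "HOL-Computational_Algebra.Formal_Power_Series"
begin

text \<open>
  Adding the element 0 to the ground set merges the subsets of $\{1,\ldots,n\}$ of sizes $b-1$ and $b$
  into the $b$-subsets of $\{0,\ldots,n\}$, so
  $F_{n,b} = F_{n,b-2} + q^{b(b-1)/2} {n+1 \brack b}_q$. The last summand is symmetric about $bn/2$,
  and by induction $F_{n,b-2}$ rises up to $(b-2)n/2$ and falls afterwards. It therefore suffices that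
  the coefficients of the summand rise up to $bn/2$, and that between $(b-2)n/2$ and $bn/2$ they rise
  at least as fast as those of $F_{n,b-2}$ fall, which is $O(n^{b-4})$.

  With $m = n + 1 - b$, the differences of the coefficients of ${m+b \brack b}_q$ are generated by
  $\prod_{i=1}^{b} (1 - q^{m+i}) / \prod_{i=2}^{b} (1 - q^i)$. For $b \ge 5$ the coefficients of
  $1 / \prod_{i=2}^{b} (1 - q^i)$ and of its product with $1 - q$ are asymptotic to monomials, with an
  error one order lower, so the first and second differences of the $q$-binomial coefficients
  are asymptotic to $m^{b-2}$ and $m^{b-3}$ times iterated differences of truncated powers, i.e.
  derivatives of B-splines. These are positive to the left of the centre (first derivative) and
  negative at the centre (second derivative). For $b \le 4$ the fluctuations of the coefficients are of
  the same order as the main term, and the inequalities are checked exactly.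
\<close>

section \<open>Subset sums and Gaussian binomials\<close>

text \<open>The ground set contains 0, so these numbers are the coefficients of q^(b choose 2) times
  the Gaussian binomial [N choose b].\<close>

definition subset_sums :: "nat \<Rightarrow> nat \<Rightarrow> nat \<Rightarrow> nat" where
  "subset_sums N b l = card {A. A \<subseteq> {..<N} \<and> card A = b \<and> \<Sum>A = l}"

text \<open>Removing 0 from a subset of {0..n} of size b + 1 keeps its sum and leaves size b or b +
  1 according to whether 0 was present.\<close>

lemma card_subsets_two_sizes:
  "card {A. A \<subseteq> {1..n} \<and> (card A = b \<or> card A = Suc b) \<and> \<Sum>A = l}
     = subset_sums (Suc n) (Suc b) l"
  unfolding subset_sums_def
proof (rule bij_betw_same_card)
  let ?g = "\<lambda>A::nat set. if card A = b then insert 0 A else A"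
  let ?S = "{A. A \<subseteq> {1..n} \<and> (card A = b \<or> card A = Suc b) \<and> \<Sum>A = l}"
  let ?T = "{A. A \<subseteq> {..<Suc n} \<and> card A = Suc b \<and> \<Sum>A = l}"
  have finS: "finite A \<and> 0 \<notin> A" if "A \<in> ?S" for A
    using that finite_subset[of A "{1..n}"] by auto
  have finT: "finite A" if "A \<in> ?T" for A
    using that finite_subset[of A "{..<Suc n}"] by auto
  show "bij_betw ?g ?S ?T"
  proof (rule bij_betw_byWitness[where f' = "\<lambda>A. A - {0}"])
    show "\<forall>A\<in>?S. ?g A - {0} = A"
    proof
      fix A assume "A \<in> ?S"
      then have "0 \<notin> A" using finS by blast
      then show "?g A - {0} = A" by simp
    qed
    show "\<forall>A\<in>?T. ?g (A - {0}) = A"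
    proof
      fix A assume A: "A \<in> ?T"
      then have "card (A - {0}) = b \<longleftrightarrow> 0 \<in> A"
        using finT[OF A] by (simp add: card_Diff_singleton_if)
      then show "?g (A - {0}) = A" by auto
    qed
    show "?g ` ?S \<subseteq> ?T"
    proof
      fix B assume "B \<in> ?g ` ?S"
      then obtain A where A: "A \<in> ?S" "B = ?g A" by blast
      then show "B \<in> ?T" using finS[of A] by fastforce
    qed
    show "(\<lambda>A. A - {0}) ` ?T \<subseteq> ?S"
    proof
      fix B assume "B \<in> (\<lambda>A. A - {0}) ` ?T"
      then obtain A where A: "A \<in> ?T" "B = A - {0}" by blast
      then have "B \<subseteq> {1..n}" by auto
      moreover have "\<Sum>B = \<Sum>A"
        using sum.remove[OF finT[OF A(1)], of 0 "\<lambda>x. x"] A(2) by (cases "0 \<in> A") auto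
      moreover have "card B = b \<or> card B = Suc b"
        using A by (auto simp: card_Diff_singleton_if)
      ultimately show "B \<in> ?S" using A(1) by simp
    qed
  qed
qed

text \<open>A strictly decreasing list has no repetitions and is recovered from its set of entries
  by sorting, so length and sum become cardinality and sum of the set.\<close>

lemma card_partitions_eq_subsets:
  "num_partitions_inside (truncated_staircase n b) l =
     card {A. A \<subseteq> {1..n} \<and> card A \<le> b \<and> \<Sum>A = l}"
  unfolding num_partitions_inside_def partitions_inside_truncated_staircase
proof (rule bij_betw_same_card[of set], rule bij_betw_byWitness[where f' = "\<lambda>A. rev (sorted_list_of_set A)"])
  have *: "distinct xs" if "sorted_wrt (>) xs" for xs :: "nat list"
    using that strict_sorted_iff[of "rev xs"] by (simp add: sorted_wrt_rev)
  let ?X = "{xs \<in> {xs. sorted_wrt (>) xs \<and> (\<forall>x\<in>set xs. 0 < x \<and> x \<le> n) \<and> length xs \<le> b}. sum_list xs = l}"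
  show "\<forall>xs\<in>?X. rev (sorted_list_of_set (set xs)) = xs"
  proof
    fix xs assume "xs \<in> ?X"
    then have "sorted_wrt (<) (rev xs)" by (simp add: sorted_wrt_rev)
    then have "sorted_list_of_set (set (rev xs)) = rev xs"
      using strict_sorted_iff sorted_list_of_set.idem_if_sorted_distinct by blast
    then show "rev (sorted_list_of_set (set xs)) = xs" by simp
  qed
  show "set ` ?X \<subseteq> {A. A \<subseteq> {1..n} \<and> card A \<le> b \<and> \<Sum>A = l}"
  proof
    fix A assume "A \<in> set ` ?X"
    then obtain xs where xs: "xs \<in> ?X" "A = set xs" by blast
    then have "distinct xs" using * by simp
    then have "card A = length xs" "\<Sum>A = sum_list xs"
      using xs sum_list_distinct_conv_sum_set[of xs "\<lambda>x. x"] by (auto simp: distinct_card)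
    then show "A \<in> {A. A \<subseteq> {1..n} \<and> card A \<le> b \<and> \<Sum>A = l}"
      using xs by (auto simp: Suc_le_eq)
  qed
  show "(\<lambda>A. rev (sorted_list_of_set A)) ` {A. A \<subseteq> {1..n} \<and> card A \<le> b \<and> \<Sum>A = l} \<subseteq> ?X"
  proof safe
    fix A assume A: "A \<subseteq> {1..n}"
    then have f: "finite A" using finite_subset by auto
    show "sorted_wrt (>) (rev (sorted_list_of_set A))"
      by (simp add: sorted_wrt_rev)
    show "sum_list (rev (sorted_list_of_set A)) = \<Sum>A"
      using f sum_list_distinct_conv_sum_set[of "sorted_list_of_set A" id] by simp
    show "length (rev (sorted_list_of_set A)) \<le> b" if "card A \<le> b" using that by simp
    fix x assume "x \<in> set (rev (sorted_list_of_set A))"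
    then show "0 < x" "x \<le> n" using A f by auto
  qed
  show "\<forall>A\<in>{A. A \<subseteq> {1..n} \<and> card A \<le> b \<and> \<Sum>A = l}. set (rev (sorted_list_of_set A)) = A"
    using finite_subset by fastforce
qed

lemma num_partitions_step:
  "num_partitions_inside (truncated_staircase n (Suc (Suc b))) l =
     num_partitions_inside (truncated_staircase n b) l + subset_sums (Suc n) (Suc (Suc b)) l"
proof -
  have "{A. A \<subseteq> {1..n} \<and> card A \<le> Suc (Suc b) \<and> \<Sum>A = l} =
    {A. A \<subseteq> {1..n} \<and> card A \<le> b \<and> \<Sum>A = l} \<union>
    {A. A \<subseteq> {1..n} \<and> (card A = Suc b \<or> card A = Suc (Suc b)) \<and> \<Sum>A = l}" by auto
  moreover have "finite {A. A \<subseteq> {1..n} \<and> P A}" for P by simp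
  ultimately show ?thesis
    unfolding card_partitions_eq_subsets card_subsets_two_sizes[symmetric]
    by (subst card_Un_disjoint[symmetric]) auto
qed

lemma num_partitions_0:
  "num_partitions_inside (truncated_staircase n 0) l = (if l = 0 then 1 else 0)"
proof -
  have "{A. A \<subseteq> {1..n} \<and> card A \<le> 0 \<and> \<Sum>A = l} = (if l = 0 then {{}} else {})"
    by (auto dest: finite_subset)
  then show ?thesis by (simp add: card_partitions_eq_subsets)
qed

lemma num_partitions_1:
  "num_partitions_inside (truncated_staircase n 1) l = subset_sums (Suc n) 1 l"
  unfolding card_partitions_eq_subsets One_nat_def card_subsets_two_sizes[symmetric, of n 0 l]
  by (rule arg_cong[of _ _ card]) (auto simp: le_Suc_eq)

text \<open>The involution x -> n - x of {0..n} preserves cardinality and reverses the sum about b *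
  n / 2.\<close>

lemma subset_sums_reflect:
  assumes "l \<le> b * n"
  shows "subset_sums (Suc n) b (b * n - l) = subset_sums (Suc n) b l"
proof -
  let ?S = "\<lambda>l. {A. A \<subseteq> {..<Suc n} \<and> card A = b \<and> \<Sum>A = l}"
  have 1: "(`) (\<lambda>x. n - x) ` ?S l \<subseteq> ?S (b * n - l)" if "l \<le> b * n" for l
  proof safe
    fix A assume A: "A \<subseteq> {..<Suc n}" "b = card A"
    have inj: "inj_on (\<lambda>x. n - x) A"
    proof (rule inj_onI)
      fix x y assume "x \<in> A" "y \<in> A" "n - x = n - y"
      moreover from this have "x \<le> n" "y \<le> n" using A by auto
      ultimately show "x = y" by simp
    qed
    then show "card ((\<lambda>x. n - x) ` A) = card A" by (rule card_image)
    have "\<Sum>((\<lambda>x. n - x) ` A) = (\<Sum>x\<in>A. n - x)"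
      using sum.reindex[OF inj, of "\<lambda>x. x"] by simp
    also have "\<dots> = card A * n - \<Sum>A"
      using A by (subst sum_subtractf_nat) auto
    finally show "\<Sum>((\<lambda>x. n - x) ` A) = card A * n - \<Sum>A" .
  qed auto
  have 2: "(\<lambda>x. n - x) ` (\<lambda>x. n - x) ` A = A" if "A \<subseteq> {..<Suc n}" for A
  proof -
    have "(\<lambda>x. n - (n - x)) ` A = (\<lambda>x. x) ` A"
      using that by (intro image_cong) auto
    then show ?thesis by (simp add: image_image)
  qed
  have "bij_betw ((`) (\<lambda>x. n - x)) (?S (b * n - l)) (?S l)"
    using 1[of l] 1[of "b * n - l"] assms 2
    by (intro bij_betw_byWitness[where f' = "(`) (\<lambda>x. n - x)"]) auto
  then show ?thesis
    unfolding subset_sums_def by (rule bij_betw_same_card)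
qed

lemma subset_sums_eq_0: "b * n < l \<Longrightarrow> subset_sums (Suc n) b l = 0"
proof -
  assume l: "b * n < l"
  have "\<Sum>A \<noteq> l" if "A \<subseteq> {..<Suc n}" "card A = b" for A
  proof -
    have "i \<le> n" if "i \<in> A" for i using that \<open>A \<subseteq> {..<Suc n}\<close> by auto
    then show ?thesis
      using sum_bounded_above[of A "\<lambda>x. x" n] that(2) l by simp
  qed
  then have "{A. A \<subseteq> {..<Suc n} \<and> card A = b \<and> \<Sum>A = l} = {}" by blast
  then show ?thesis by (simp add: subset_sums_def)
qed

lemma subset_sums_0: "subset_sums N 0 l = (if l = 0 then 1 else 0)"
proof -
  have "{A. A \<subseteq> {..<N} \<and> card A = 0 \<and> \<Sum>A = l} = (if l = 0 then {{}} else {})"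
    by (auto dest: finite_subset)
  then show ?thesis by (simp add: subset_sums_def)
qed

lemma subset_sums_0_Suc: "subset_sums 0 (Suc b) l = 0"
  by (auto simp: subset_sums_def)

text \<open>The q-Pascal rule: a subset of {0..N} omits N or contains it. The guard
  \<open>N \<le> l\<close> protects the truncated subtraction.\<close>

lemma subset_sums_Suc_Suc:
  "subset_sums (Suc N) (Suc b) l = subset_sums N (Suc b) l + (if N \<le> l then subset_sums N b (l - N) else 0)"
proof -
  let ?S = "\<lambda>N b l. {A. A \<subseteq> {..<N} \<and> card A = b \<and> \<Sum>A = l}"
  have f: "finite (?S N b l)" for N b l :: nat
    by (rule finite_subset[of _ "Pow {..<N}"]) auto
  have fin: "finite A" if "A \<subseteq> {..<M}" for A :: "nat set" and M using that finite_subset by auto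
  have "?S (Suc N) (Suc b) l = ?S N (Suc b) l \<union> (if N \<le> l then insert N ` ?S N b (l - N) else {})" (is "?L = ?R")
  proof (intro set_eqI iffI)
    fix A assume A: "A \<in> ?L"
    then have fA: "finite A" using fin by blast
    show "A \<in> ?R"
    proof (cases "N \<in> A")
      case True
      define B where "B = A - {N}"
      have B: "A = insert N B" "N \<notin> B" "finite B" using True fA by (auto simp: B_def)
      have "B \<subseteq> {..<N}" using A B(1,2) by (auto simp: less_Suc_eq)
      moreover have "card B = b" "N + \<Sum>B = l" using A B by auto
      ultimately have "B \<in> ?S N b (l - N)" "N \<le> l" by auto
      then show ?thesis unfolding B(1) by simp
    next
      case False
      then show ?thesis using A by (auto simp: less_Suc_eq)
    qed
  next
    fix A assume A: "A \<in> ?R"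
    show "A \<in> ?L"
    proof (cases "A \<in> ?S N (Suc b) l")
      case False
      then obtain B where B: "N \<le> l" "B \<in> ?S N b (l - N)" "A = insert N B"
        using A by (auto split: if_splits)
      then have "finite B" "N \<notin> B" using fin by auto
      then show ?thesis using B by auto
    qed auto
  qed
  moreover have "inj_on (insert N) (?S N b (l - N))"
  proof (rule inj_onI)
    fix A B assume AB: "A \<in> ?S N b (l - N)" "B \<in> ?S N b (l - N)" "insert N A = insert N B"
    then have "N \<notin> A" "N \<notin> B" by auto
    then show "A = B" using AB(3) by (simp add: insert_ident)
  qed
  moreover have "?S N (Suc b) l \<inter> insert N ` ?S N b (l - N) = {}" by auto
  ultimately show ?thesis
    unfolding subset_sums_def using f by (simp add: card_Un_disjoint card_image)
qed

section \<open>Generating functions of subset sums and the product formula\<close>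

definition subset_fps :: "nat \<Rightarrow> nat \<Rightarrow> real fps" where
  "subset_fps N b = Abs_fps (\<lambda>l. subset_sums N b l)"

lemma subset_fps_0: "subset_fps N 0 = 1"
  by (simp add: subset_fps_def fps_eq_iff subset_sums_0)

lemma subset_fps_0_Suc: "subset_fps 0 (Suc b) = 0"
  by (simp add: subset_fps_def fps_eq_iff subset_sums_0_Suc)

lemma subset_fps_Suc_Suc:
  "subset_fps (Suc N) (Suc b) = subset_fps N (Suc b) + fps_X ^ N * subset_fps N b"
  by (simp add: subset_fps_def fps_eq_iff subset_sums_Suc_Suc fps_X_power_mult_nth)

text \<open>For $N < b$ the right-hand side contains the factor $1 - q^0 = 0$, so truncated subtraction is harmless.\<close>

lemma subset_fps_q_binomial:
  "subset_fps N b * (\<Prod>i=1..b. 1 - fps_X ^ i) =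
     fps_X ^ (b choose 2) * (\<Prod>i<b. 1 - fps_X ^ (N - i))"
proof (induction N arbitrary: b)
  case 0
  show ?case by (cases b) (simp_all add: subset_fps_0 subset_fps_0_Suc lessThan_Suc_eq_insert_0 numeral_2_eq_2)
next
  case (Suc N)
  show ?case
  proof (cases b)
    case 0
    then show ?thesis by (simp add: subset_fps_0 numeral_2_eq_2)
  next
    case (Suc b')
    let ?X = "fps_X :: real fps"
    have tri: "Suc b' choose 2 = (b' choose 2) + b'" by (simp add: numeral_2_eq_2)
    let ?Q = "\<Prod>i<b'. 1 - ?X ^ (N - i)"
    let ?D = "\<Prod>i=1..b'. 1 - ?X ^ i"
    have IH1: "subset_fps N (Suc b') * (?D * (1 - ?X ^ Suc b')) = ?X ^ (b' choose 2) * ?X ^ b' * (?Q * (1 - ?X ^ (N - b')))"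
      using Suc.IH[of "Suc b'"] by (simp add: tri power_add mult.assoc)
    have IH2: "subset_fps N b' * ?D = ?X ^ (b' choose 2) * ?Q"
      using Suc.IH[of b'] .
    have Q: "(\<Prod>i<Suc b'. 1 - ?X ^ (Suc N - i)) = (1 - ?X ^ Suc N) * ?Q"
      by (subst prod.lessThan_Suc_shift) simp
    \<comment> \<open>The q-Pascal rule with the denominators and the factor X^(b' choose 2)
      cleared.\<close>
    have *: "?X ^ b' * (?Q * (1 - ?X ^ (N - b'))) + ?X ^ N * ?Q * (1 - ?X ^ Suc b') = ?X ^ b' * ((1 - ?X ^ Suc N) * ?Q)"
    proof (cases "b' \<le> N")
      case True
      then obtain r where "N = b' + r" using le_Suc_ex by blast
      then show ?thesis by (simp add: algebra_simps power_add)
    next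
      case False
      then have "?Q = 0" by (intro prod_zero bexI[of _ N]) auto
      then show ?thesis by (simp only: mult_zero_left mult_zero_right add_0)
    qed
    have "subset_fps (Suc N) b * (\<Prod>i=1..b. 1 - ?X ^ i) =
      subset_fps N (Suc b') * (?D * (1 - ?X ^ Suc b')) + ?X ^ N * (subset_fps N b' * ?D) * (1 - ?X ^ Suc b')"
      by (simp add: Suc subset_fps_Suc_Suc algebra_simps)
    also have "\<dots> = ?X ^ (b' choose 2) * (?X ^ b' * (?Q * (1 - ?X ^ (N - b'))) + ?X ^ N * ?Q * (1 - ?X ^ Suc b'))"
      unfolding IH1 IH2 by (simp add: algebra_simps)
    also have "\<dots> = ?X ^ (b choose 2) * (\<Prod>i<b. 1 - ?X ^ (Suc N - i))"
      unfolding * Suc tri power_add Q by (simp add: algebra_simps)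
    finally show ?thesis .
  qed
qed

definition geo_fps :: "nat \<Rightarrow> real fps" where
  "geo_fps i = inverse (1 - fps_X ^ i)"

lemma geo_fps: "i > 0 \<Longrightarrow> (1 - fps_X ^ i) * geo_fps i = 1"
  unfolding geo_fps_def by (rule inverse_mult_eq_1') simp

text \<open>Counts partitions into parts between 2 and b. The part 1 is missing because taking first
  differences cancels the factor 1/(1 - q).\<close>

definition part_fps :: "nat \<Rightarrow> real fps" where
  "part_fps b = (\<Prod>i=2..b. geo_fps i)"

lemma part_fps: "(\<Prod>i=2..b. 1 - fps_X ^ i) * part_fps b = 1"
  unfolding part_fps_def prod.distrib[symmetric] by (intro prod.neutral) (auto simp: geo_fps)

text \<open>The numerator of the Gaussian binomial [m + b choose b] when \<open>j\<close> = b. A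
  separate \<open>j\<close> lets the factors be adjoined one at a time by induction.\<close>

definition top_factors :: "nat \<Rightarrow> nat \<Rightarrow> real fps" where
  "top_factors m j = (\<Prod>i=1..j. 1 - fps_X ^ (m + i))"

lemma top_factors_reverse: "(\<Prod>i<b. 1 - fps_X ^ (m + b - i)) = top_factors m b"
  unfolding top_factors_def
  by (rule prod.reindex_bij_witness[of _ "\<lambda>i. b - i" "\<lambda>i. b - i"]) auto

lemma subset_fps_diff:
  assumes "b > 0"
  shows "(1 - fps_X) * subset_fps (m + b) b = fps_X ^ (b choose 2) * (top_factors m b * part_fps b)"
proof -
  let ?X = "fps_X :: real fps"
  have D: "(\<Prod>i=1..b. 1 - ?X ^ i) = (1 - ?X) * (\<Prod>i=2..b. 1 - ?X ^ i)"
    using assms by (subst prod.atLeast_Suc_atMost) (auto simp: numeral_2_eq_2)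
  have "(1 - ?X) * subset_fps (m + b) b = subset_fps (m + b) b * (\<Prod>i=1..b. 1 - ?X ^ i) * part_fps b"
    unfolding D using part_fps[of b] by (simp add: mult_ac)
  also have "\<dots> = ?X ^ (b choose 2) * (top_factors m b * part_fps b)"
    unfolding subset_fps_q_binomial top_factors_reverse by (simp add: mult.assoc)
  finally show ?thesis .
qed

text \<open>Integer indices make the coefficients of $q^i F$ a plain shift of those of $F$.\<close>

definition int_nth :: "real fps \<Rightarrow> int \<Rightarrow> real" where
  "int_nth F k = (if k < 0 then 0 else fps_nth F (nat k))"

lemma int_nth_neg [simp]: "k < 0 \<Longrightarrow> int_nth F k = 0"
  by (simp add: int_nth_def)

lemma int_nth_diff: "int_nth (F - G) k = int_nth F k - int_nth G k"
  by (simp add: int_nth_def)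

lemma int_nth_add: "int_nth (F + G) k = int_nth F k + int_nth G k"
  by (simp add: int_nth_def)

lemma int_nth_one: "int_nth 1 k = (if k = 0 then 1 else 0)"
  by (auto simp: int_nth_def)

lemma int_nth_X_power_mult: "int_nth (fps_X ^ i * F) k = int_nth F (k - int i)"
  by (auto simp: int_nth_def fps_X_power_mult_nth nat_diff_distrib' nat_less_iff)

lemma int_nth_one_minus_mult: "int_nth ((1 - fps_X ^ i) * F) k = int_nth F k - int_nth F (k - int i)"
  by (simp add: left_diff_distrib int_nth_diff int_nth_X_power_mult)

lemma int_nth_one_minus_X_mult: "int_nth ((1 - fps_X) * F) k = int_nth F k - int_nth F (k - 1)"
  using int_nth_one_minus_mult[of 1] by simp

text \<open>Division by 1 - q^i becomes a recursion with step \<open>i\<close>; the coefficient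
  computations below run it by strong induction on \<open>nat k\<close>.\<close>

lemma int_nth_geo: "i > 0 \<Longrightarrow> int_nth (geo_fps i * F) k = int_nth F k + int_nth (geo_fps i * F) (k - int i)"
  using int_nth_one_minus_mult[of i "geo_fps i * F" k] geo_fps[of i] by (simp add: mult.assoc[symmetric])

section \<open>Iterated differences of truncated powers\<close>

text \<open>For 0 < d < b this is, up to a constant factor, the derivative of order b - 1 - d of the
  cardinal B-spline of degree b - 1 on [0, b]. For d = 0 the base is the constant 1, not a step
  function, which explains the recurring hypothesis \<open>d > 0\<close>.\<close>

fun spline :: "nat \<Rightarrow> nat \<Rightarrow> real \<Rightarrow> real" where
  "spline 0 d t = max 0 t ^ d"
| "spline (Suc b) d t = spline b d t - spline b d (t - 1)"

declare spline.simps(2) [simp del]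

lemma spline_nonpos: "d > 0 \<Longrightarrow> t \<le> 0 \<Longrightarrow> spline b d t = 0"
  by (induction b arbitrary: t) (auto simp: spline.simps(2))

text \<open>At the knot 0 the difference quotient is \<open>max 0 h ^ d\<close>, which tends to 0
  because \<open>d > 0\<close>.\<close>

lemma pos_part_power_has_derivative:
  fixes t :: real
  assumes "d > 0"
  shows "((\<lambda>t::real. max 0 t ^ Suc d) has_real_derivative Suc d * max 0 t ^ d) (at t)"
proof -
  consider "t > 0" | "t < 0" | "t = 0" by linarith
  then show ?thesis
  proof cases
    case 1
    have "((\<lambda>t::real. t ^ Suc d) has_real_derivative Suc d * t ^ d) (at t)"
      using DERIV_pow[of "Suc d" t] by (simp del: power_Suc)
    moreover have "\<forall>\<^sub>F x in nhds t. x ^ Suc d = max 0 x ^ Suc d"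
      using eventually_nhds_in_open[of "{0<..}" t] 1 by (auto elim!: eventually_mono)
    ultimately show ?thesis
      using 1 DERIV_cong_ev[of t t "\<lambda>t. t ^ Suc d" "\<lambda>t. max 0 t ^ Suc d" "Suc d * t ^ d"]
      by (simp del: power_Suc)
  next
    case 2
    have "\<forall>\<^sub>F x in nhds t. 0 = max 0 x ^ Suc d"
      using eventually_nhds_in_open[of "{..<0}" t] 2 by (auto elim!: eventually_mono)
    then show ?thesis
      using 2 assms DERIV_cong_ev[of t t "\<lambda>t. 0" "\<lambda>t. max 0 t ^ Suc d" 0]
      by (simp add: zero_power)
  next
    case 3
    have "((\<lambda>h::real. max 0 h ^ d) \<longlongrightarrow> max 0 0 ^ d) (at 0)"
      by (intro tendsto_intros)
    also have "max 0 0 ^ d = (0::real)"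
      using assms by simp
    finally have "((\<lambda>h::real. max 0 h ^ Suc d / h) \<longlongrightarrow> 0) (at 0)"
    proof (rule tendsto_0_le[where K=1])
      show "\<forall>\<^sub>F h in at (0::real). norm (max 0 h ^ Suc d / h) \<le> norm (max 0 h ^ d) * 1"
        by (rule always_eventually) (auto simp: max_def)
    qed
    then show ?thesis
      using 3 assms by (simp add: DERIV_def zero_power)
  qed
qed

lemma spline_has_derivative:
  assumes "d > 0"
  shows "(spline b (Suc d) has_real_derivative Suc d * spline b d t) (at t)"
proof (induction b arbitrary: t)
  case 0
  then show ?case using pos_part_power_has_derivative[OF assms] by simp
next
  case (Suc b)
  have "((\<lambda>t. spline b (Suc d) (t - 1)) has_real_derivative Suc d * spline b d (t - 1)) (at t)"
    using Suc[of "t - 1"] DERIV_shift[of "spline b (Suc d)" "Suc d * spline b d (t - 1)" t "-1"] by simp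
  from DERIV_diff[OF Suc[of t] this] show ?case
    by (simp add: spline.simps(2)[abs_def] algebra_simps)
qed

lemma continuous_spline: "isCont (spline b d) t"
proof (induction b arbitrary: t)
  case 0
  show ?case by (simp add: continuous_intros)
next
  case (Suc b)
  have "isCont (\<lambda>t. spline b d t - spline b d (t - 1)) t"
    using Suc by (intro continuous_intros isCont_o2[where g="spline b d" and f="\<lambda>t. t - 1"])
  then show ?case by (simp add: spline.simps(2)[abs_def])
qed

lemma spline_reflect_step:
  fixes t :: real
  assumes "\<And>t::real. spline b d (b - t) = (-1) ^ (b + d + 1) * spline b d t"
  shows "spline (Suc b) d (Suc b - t) = (-1) ^ (Suc b + d + 1) * spline (Suc b) d t"
proof -
  have "real (Suc b) - t = real b - (t - 1)" "real (Suc b) - t - 1 = b - t" by auto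
  then show ?thesis
    using assms[of "t - 1"] assms[of t] by (simp add: spline.simps(2) algebra_simps)
qed

text \<open>Each further difference preserves the symmetry up to sign, so for fixed degree only the
  least admissible b matters. There the symmetry of one degree less shows that both sides have the
  same derivative.\<close>

lemma spline_reflect:
  fixes t :: real
  assumes "0 < d" "d < b"
  shows "spline b d (b - t) = (-1) ^ (b + d + 1) * spline b d t"
  using assms
proof (induction d arbitrary: b t rule: nat_induct_non_zero)
  case 1
  then have "Suc 1 \<le> b" by simp
  then show ?case
  proof (induction b arbitrary: t rule: dec_induct)
    case base
    then show ?case by (simp add: spline.simps(2) max_def)
  next
    case (step b)
    then show ?case by (intro spline_reflect_step) auto
  qed
next
  case (Suc d)
  from Suc.prems have "Suc (Suc d) \<le> b" by simp
  then show ?case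
  proof (induction b arbitrary: t rule: dec_induct)
    case base
    let ?b = "Suc (Suc d)"
    let ?h = "\<lambda>t::real. spline ?b (Suc d) (?b - t) - spline ?b (Suc d) t"
    have "(?h has_real_derivative 0) (at t)" for t :: real
    proof -
      have 1: "((\<lambda>t::real. spline ?b (Suc d) (?b - t)) has_real_derivative
          (Suc d * spline ?b d (?b - t)) * (-1)) (at t)"
        by (rule DERIV_chain2[OF spline_has_derivative[OF \<open>d > 0\<close>]])
           (auto intro!: derivative_eq_intros)
      have 2: "spline ?b d (?b - t) = - spline ?b d t"
        using Suc.IH[of ?b t] by simp
      show ?thesis
        using DERIV_diff[OF 1 spline_has_derivative[OF \<open>d > 0\<close>, of ?b t]] unfolding 2 by simp
    qed
    \<comment> \<open>A constant function is evaluated at the centre, where its two terms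
      coincide.\<close>
    then have "?h t = ?h (?b / 2)"
      by (intro DERIV_isconst_all) auto
    also have "?h (?b / 2) = 0" by (simp add: field_simps)
    finally show ?case by simp
  next
    case (step b)
    then show ?case by (intro spline_reflect_step) auto
  qed
qed

text \<open>The value is B(t) - B(t - 1) for a B that is symmetric about (d + 1)/2 and increases up
  to there; left of (d + 2)/2 the point t is closer to that centre than t - 1.\<close>

lemma spline_pos_of_strict_mono:
  fixes t :: real
  assumes d: "d > 0"
    and mono: "\<And>x y :: real. 0 \<le> x \<Longrightarrow> x < y \<Longrightarrow> 2 * y \<le> Suc d \<Longrightarrow> spline (Suc d) d x < spline (Suc d) d y"
    and t: "0 < t" "2 * t < Suc (Suc d)"
  shows "0 < spline (Suc (Suc d)) d t"
proof -
  let ?B = "spline (Suc d) d"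
  \<comment> \<open>Whichever of t and its mirror image lies in the left half; t - 1 < u is
    equivalent to 2 * t < d + 2.\<close>
  define u where "u = min t (Suc d - t)"
  have "?B u = ?B t"
    using spline_reflect[of d "Suc d" t] d by (auto simp: u_def min_def)
  have u: "0 < u" "t - 1 < u" "2 * u \<le> Suc d" using t d unfolding u_def min_def by auto
  \<comment> \<open>Monotonicity is available only from 0 on, but B vanishes to the left of
    0.\<close>
  have "?B (t - 1) = ?B (max 0 (t - 1))"
    using spline_nonpos[OF d] by (auto simp: max_def)
  also have "\<dots> < ?B u"
    using u by (intro mono) auto
  finally show ?thesis using \<open>?B u = ?B t\<close> by (simp add: spline.simps(2)[of "Suc d"])
qed

text \<open>The derivative is a positive multiple of \<open>spline (Suc (Suc d)) d\<close>, which
  the previous lemma makes positive on the left half, given monotonicity one degree lower.\<close>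

lemma spline_strict_mono:
  fixes x y :: real
  assumes "d > 0" "0 \<le> x" "x < y" "2 * y \<le> Suc d"
  shows "spline (Suc d) d x < spline (Suc d) d y"
  using assms
proof (induction d arbitrary: x y rule: nat_induct_non_zero)
  case 1
  then show ?case by (simp add: spline.simps(2))
next
  case (Suc d)
  have pos: "0 < spline (Suc (Suc d)) d t" if "0 < t" "2 * t < Suc (Suc d)" for t :: real
    using spline_pos_of_strict_mono[OF \<open>d > 0\<close> Suc.IH that] by blast
  show ?case
  proof (rule DERIV_pos_imp_increasing_open[OF \<open>x < y\<close>])
    fix z assume "x < z" "z < y"
    then show "\<exists>D. (spline (Suc (Suc d)) (Suc d) has_real_derivative D) (at z) \<and> 0 < D"
      using pos[of z] Suc.prems spline_has_derivative[OF \<open>d > 0\<close>, of "Suc (Suc d)" z]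
      by (intro exI[of _ "Suc d * spline (Suc (Suc d)) d z"] conjI) auto
  next
    show "continuous_on {x..y} (spline (Suc (Suc d)) (Suc d))"
      by (intro continuous_at_imp_continuous_on ballI continuous_spline)
  qed
qed

lemma spline_pos:
  fixes t :: real
  assumes "d > 0" "0 < t" "2 * t < Suc (Suc d)"
  shows "0 < spline (Suc (Suc d)) d t"
  using spline_pos_of_strict_mono assms spline_strict_mono by blast

text \<open>The value is a difference of \<open>spline (d + 2) d\<close> at two points symmetric
  about its centre of antisymmetry, hence -2 times a positive value. It is the sign of the second
  differences in the middle.\<close>

lemma spline_centre_neg:
  assumes "d > 0"
  shows "spline (d + 3) d ((real d + 3) / 2) < 0"
proof -
  let ?G = "spline (Suc (Suc d)) d"
  have "?G ((real d + 3) / 2) = ?G (Suc (Suc d) - (real d + 1) / 2)"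
    by (rule arg_cong[of _ _ ?G]) (simp add: field_simps)
  also have "\<dots> = - ?G ((real d + 1) / 2)"
    using spline_reflect[of d "Suc (Suc d)" "(real d + 1) / 2"] assms by simp
  finally have 1: "?G ((real d + 3) / 2) = - ?G ((real d + 1) / 2)" .
  have 2: "(real d + 3) / 2 - 1 = (real d + 1) / 2" by (simp add: field_simps)
  have "0 < ?G ((real d + 1) / 2)" by (rule spline_pos) (use assms in auto)
  moreover have "spline (d + 3) d ((real d + 3) / 2) = ?G ((real d + 3) / 2) - ?G ((real d + 3) / 2 - 1)"
    by (simp add: numeral_3_eq_3 spline.simps(2)[of "Suc (Suc d)"])
  ultimately show ?thesis
    unfolding 1 2 by linarith
qed

section \<open>Asymptotics of coefficients\<close>

lemma power_diff_Lipschitz: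
  fixes A :: real
  assumes "A \<ge> 0"
  shows "\<exists>L\<ge>0. \<forall>x y. 0 \<le> x \<longrightarrow> x \<le> A \<longrightarrow> 0 \<le> y \<longrightarrow> y \<le> A \<longrightarrow> \<bar>x ^ d - y ^ d\<bar> \<le> L * \<bar>x - y\<bar>"
proof (induction d)
  case 0
  show ?case by (rule exI[of _ 0]) simp
next
  case (Suc d)
  then obtain L where L: "L \<ge> 0"
    "\<And>x y. 0 \<le> x \<Longrightarrow> x \<le> A \<Longrightarrow> 0 \<le> y \<Longrightarrow> y \<le> A \<Longrightarrow> \<bar>x ^ d - y ^ d\<bar> \<le> L * \<bar>x - y\<bar>" by blast
  show ?case
  proof (intro exI[of _ "A * L + A ^ d"] conjI allI impI)
    show "0 \<le> A * L + A ^ d" using assms L by simp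
    fix x y assume xy: "0 \<le> x" "x \<le> A" "0 \<le> y" "y \<le> A"
    have "x ^ Suc d - y ^ Suc d = x * (x ^ d - y ^ d) + (x - y) * y ^ d"
      by (simp add: algebra_simps)
    then have "\<bar>x ^ Suc d - y ^ Suc d\<bar> \<le> \<bar>x\<bar> * \<bar>x ^ d - y ^ d\<bar> + \<bar>x - y\<bar> * \<bar>y ^ d\<bar>"
      by (metis abs_triangle_ineq abs_mult)
    also have "\<dots> \<le> A * (L * \<bar>x - y\<bar>) + \<bar>x - y\<bar> * A ^ d"
      using xy L by (intro add_mono mult_mono power_mono) (auto simp: power_mono)
    finally show "\<bar>x ^ Suc d - y ^ Suc d\<bar> \<le> (A * L + A ^ d) * \<bar>x - y\<bar>"
      by (simp add: algebra_simps)
  qed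
qed

text \<open>Since \<open>max 0\<close> is a contraction, the Lipschitz bound for powers on [0, A]
  extends to the whole half-line left of A and passes to differences.\<close>

lemma spline_Lipschitz:
  fixes A :: real
  assumes "A \<ge> 0"
  shows "\<exists>L\<ge>0. \<forall>x y. x \<le> A \<longrightarrow> y \<le> A \<longrightarrow> \<bar>spline j d x - spline j d y\<bar> \<le> L * \<bar>x - y\<bar>"
proof (induction j)
  case 0
  obtain L where L: "L \<ge> 0"
    "\<And>x y. 0 \<le> x \<Longrightarrow> x \<le> A \<Longrightarrow> 0 \<le> y \<Longrightarrow> y \<le> A \<Longrightarrow> \<bar>x ^ d - y ^ d\<bar> \<le> L * \<bar>x - y\<bar>"
    using power_diff_Lipschitz[OF assms] by blast
  have "\<bar>spline 0 d x - spline 0 d y\<bar> \<le> L * \<bar>x - y\<bar>" if "x \<le> A" "y \<le> A" for x y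
  proof -
    have "\<bar>spline 0 d x - spline 0 d y\<bar> \<le> L * \<bar>max 0 x - max 0 y\<bar>"
      using L(2)[of "max 0 x" "max 0 y"] that assms by simp
    also have "\<dots> \<le> L * \<bar>x - y\<bar>"
      using L(1) by (intro mult_left_mono) auto
    finally show ?thesis .
  qed
  then show ?case using L(1) by blast
next
  case (Suc j)
  then obtain L where L: "L \<ge> 0"
    "\<And>x y. x \<le> A \<Longrightarrow> y \<le> A \<Longrightarrow> \<bar>spline j d x - spline j d y\<bar> \<le> L * \<bar>x - y\<bar>" by blast
  have "\<bar>spline (Suc j) d x - spline (Suc j) d y\<bar> \<le> 2 * L * \<bar>x - y\<bar>" if "x \<le> A" "y \<le> A" for x y
    using L(2)[of x y] L(2)[of "x - 1" "y - 1"] that by (simp add: spline.simps(2))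
  then show ?case using L(1) by (intro exI[of _ "2 * L"]) auto
qed

text \<open>The error is one order below the main term; the base 1 + k keeps the bound positive at k
  = 0.\<close>

definition asymp_monom :: "real fps \<Rightarrow> real \<Rightarrow> nat \<Rightarrow> bool" where
  "asymp_monom F c d \<longleftrightarrow>
     (\<exists>K\<ge>0. \<forall>k\<ge>0. \<bar>int_nth F k - c * of_int k ^ Suc d\<bar> \<le> K * (1 + of_int k) ^ d)"

lemma top_factors_Suc: "top_factors m (Suc j) * F = (1 - fps_X ^ (m + Suc j)) * (top_factors m j * F)"
  by (simp add: top_factors_def mult_ac)

lemma int_nth_top_factors_Suc:
  "int_nth (top_factors m (Suc j) * F) k = int_nth (top_factors m j * F) k - int_nth (top_factors m j * F) (k - int (m + Suc j))"
  unfolding top_factors_Suc by (rule int_nth_one_minus_mult)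

lemma int_nth_top_factors_0: "int_nth (top_factors m 0 * F) k = int_nth F k"
  by (simp add: top_factors_def)

text \<open>A factor 1 - q^(m + j + 1) subtracts a copy shifted by m + j + 1. On the scale x = k / m
  this is a shift by 1, which is the step of \<open>spline\<close>, plus O(1/m), which the Lipschitz
  bound turns into an error of lower order.\<close>

lemma top_factors_asymp:
  assumes "asymp_monom F c d" and A: "A \<ge> 0"
  shows "\<exists>K\<ge>0. \<forall>m>0. \<forall>k. of_int k \<le> A * real m \<longrightarrow>
    \<bar>int_nth (top_factors m j * F) k - c * real m ^ Suc d * spline j (Suc d) (of_int k / real m)\<bar> \<le> K * real m ^ d"
proof (induction j)
  case 0
  obtain K where K: "K \<ge> 0" "\<And>k. k \<ge> 0 \<Longrightarrow> \<bar>int_nth F k - c * of_int k ^ Suc d\<bar> \<le> K * (1 + of_int k) ^ d"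
    using assms unfolding asymp_monom_def by blast
  show ?case
  proof (intro exI[of _ "K * (1 + A) ^ d"] conjI allI impI)
    show "0 \<le> K * (1 + A) ^ d" using K A by simp
    fix m k assume m: "(0::nat) < m" and k: "real_of_int k \<le> A * real m"
    show "\<bar>int_nth (top_factors m 0 * F) k - c * real m ^ Suc d * spline 0 (Suc d) (of_int k / real m)\<bar>
      \<le> K * (1 + A) ^ d * real m ^ d"
    proof (cases "k < 0")
      case True
      then have "spline 0 (Suc d) (of_int k / real m) = 0"
        by (intro spline_nonpos) (auto simp: divide_nonpos_nonneg)
      then show ?thesis using True K A by (simp add: int_nth_top_factors_0 del: spline.simps)
    next
      case False
      then have eq: "real m ^ Suc d * spline 0 (Suc d) (of_int k / real m) = of_int k ^ Suc d"
        using m by (simp add: max_def power_divide flip: power_Suc)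
      have "\<bar>int_nth (top_factors m 0 * F) k - c * real m ^ Suc d * spline 0 (Suc d) (of_int k / real m)\<bar>
        \<le> K * (1 + of_int k) ^ d"
        using K(2)[of k] False unfolding int_nth_top_factors_0 mult.assoc eq by simp
      also have "\<dots> \<le> K * ((1 + A) * real m) ^ d"
      proof -
        have "1 + real_of_int k \<le> real m + A * real m" using m k by linarith
        then show ?thesis
          using False K by (intro mult_left_mono power_mono) (auto simp: algebra_simps)
      qed
      finally show ?thesis by (simp add: power_mult_distrib mult.assoc)
    qed
  qed
next
  case (Suc j)
  then obtain K where K: "K \<ge> 0" "\<And>m k. m > 0 \<Longrightarrow> of_int k \<le> A * real m \<Longrightarrow>
    \<bar>int_nth (top_factors m j * F) k - c * real m ^ Suc d * spline j (Suc d) (of_int k / real m)\<bar> \<le> K * real m ^ d"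
    by blast
  obtain L where L: "L \<ge> 0"
    "\<And>x y. x \<le> A \<Longrightarrow> y \<le> A \<Longrightarrow> \<bar>spline j (Suc d) x - spline j (Suc d) y\<bar> \<le> L * \<bar>x - y\<bar>"
    using spline_Lipschitz[OF A] by blast
  \<comment> \<open>Two errors from the induction hypothesis and one from moving the argument by (j
    + 1)/m.\<close>
  let ?K = "2 * K + \<bar>c\<bar> * L * Suc j"
  show ?case
  proof (intro exI[of _ ?K] conjI allI impI)
    show "0 \<le> ?K" using K L by simp
    fix m k assume m: "(0::nat) < m" and k: "real_of_int k \<le> A * real m"
    define x where "x = of_int k / real m"
    let ?k' = "k - int (m + Suc j)"
    let ?x' = "of_int ?k' / real m"
    have x': "?x' = x - 1 - Suc j / m"
      using m by (simp add: x_def field_simps)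
    have xA: "x \<le> A" using m k by (simp add: x_def field_simps)
    have k': "real_of_int ?k' \<le> A * real m" using k by simp
    let ?M = "c * real m ^ Suc d"
    have 1: "\<bar>int_nth (top_factors m j * F) k - ?M * spline j (Suc d) x\<bar> \<le> K * real m ^ d"
      using K(2)[OF m k] by (simp only: x_def)
    have 2: "\<bar>int_nth (top_factors m j * F) ?k' - ?M * spline j (Suc d) ?x'\<bar> \<le> K * real m ^ d"
      using K(2)[OF m k'] .
    have "\<bar>spline j (Suc d) ?x' - spline j (Suc d) (x - 1)\<bar> \<le> L * \<bar>?x' - (x - 1)\<bar>"
    proof (intro L(2))
      have "0 \<le> Suc j / m" by simp
      then show "?x' \<le> A" "x - 1 \<le> A" using xA unfolding x' by linarith+
    qed
    also have "\<dots> = L * (Suc j / m)" unfolding x' by simp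
    finally have "\<bar>?M\<bar> * \<bar>spline j (Suc d) ?x' - spline j (Suc d) (x - 1)\<bar> \<le> \<bar>?M\<bar> * (L * (Suc j / m))"
      by (intro mult_left_mono) auto
    also have "\<dots> = \<bar>c\<bar> * L * Suc j * real m ^ d"
      using m by (simp add: abs_mult)
    finally have 3: "\<bar>?M * spline j (Suc d) ?x' - ?M * spline j (Suc d) (x - 1)\<bar> \<le> \<bar>c\<bar> * L * Suc j * real m ^ d"
      by (simp only: abs_mult[symmetric] right_diff_distrib)
    have "?M * spline (Suc j) (Suc d) x = ?M * spline j (Suc d) x - ?M * spline j (Suc d) (x - 1)"
      by (simp only: spline.simps right_diff_distrib)
    moreover have "?K * real m ^ d = K * real m ^ d + K * real m ^ d + \<bar>c\<bar> * L * Suc j * real m ^ d"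
      by (simp add: algebra_simps)
    ultimately show "\<bar>int_nth (top_factors m (Suc j) * F) k - ?M * spline (Suc j) (Suc d) (of_int k / real m)\<bar>
      \<le> ?K * real m ^ d"
      using 1 2 3 unfolding int_nth_top_factors_Suc x_def[symmetric] by linarith
  qed
qed

section \<open>How a factor 1/(1 - q^i) changes the asymptotics\<close>

lemma power_diff_linear_approx:
  fixes a :: real
  assumes "a \<ge> 0"
  shows "\<exists>M\<ge>0. \<forall>x\<ge>a. \<bar>x ^ Suc (Suc d) - (x - a) ^ Suc (Suc d) - a * Suc (Suc d) * x ^ Suc d\<bar> \<le> M * (1 + x) ^ d"
proof (induction d)
  case 0
  show ?case
    by (rule exI[of _ "a\<^sup>2"]) (auto simp: algebra_simps power2_eq_square)
next
  case (Suc d)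
  let ?e = "\<lambda>d x. x ^ Suc (Suc d) - (x - a) ^ Suc (Suc d) - a * Suc (Suc d) * x ^ Suc d"
  from Suc obtain M where M: "M \<ge> 0" "\<And>x. x \<ge> a \<Longrightarrow> \<bar>?e d x\<bar> \<le> M * (1 + x) ^ d" by blast
  show ?case
  proof (intro exI[of _ "a\<^sup>2 * Suc (Suc d) + M"] conjI allI impI)
    show "0 \<le> a\<^sup>2 * Suc (Suc d) + M" using M by simp
    fix x assume x: "x \<ge> a"
    \<comment> \<open>Multiplying the expansion of degree d + 2 by x - a reproduces that of degree d
      + 3 up to one term in a^2.\<close>
    have "?e (Suc d) x = - (a\<^sup>2 * Suc (Suc d) * x ^ Suc d) + (x - a) * ?e d x"
      by (simp add: algebra_simps power2_eq_square)
    then have "\<bar>?e (Suc d) x\<bar> \<le> a\<^sup>2 * Suc (Suc d) * x ^ Suc d + (x - a) * \<bar>?e d x\<bar>"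
    proof -
      have "\<bar>(x - a) * ?e d x\<bar> = (x - a) * \<bar>?e d x\<bar>" using x by (simp only: abs_mult abs_of_nonneg diff_ge_0_iff_ge)
      moreover have "\<bar>- (a\<^sup>2 * Suc (Suc d) * x ^ Suc d)\<bar> = a\<^sup>2 * Suc (Suc d) * x ^ Suc d"
        using x assms by (simp add: abs_mult)
      ultimately show ?thesis
        unfolding \<open>?e (Suc d) x = _\<close> by (metis abs_triangle_ineq)
    qed
    also have "\<dots> \<le> a\<^sup>2 * Suc (Suc d) * (1 + x) ^ Suc d + (1 + x) * (M * (1 + x) ^ d)"
      using x assms M by (intro add_mono mult_mono mult_left_mono power_mono) auto
    finally show "\<bar>?e (Suc d) x\<bar> \<le> (a\<^sup>2 * Suc (Suc d) + M) * (1 + x) ^ Suc d"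
      by (simp add: algebra_simps)
  qed
qed

lemma power_pos_part_linear_approx:
  fixes a :: real
  assumes "a \<ge> 0"
  shows "\<exists>M\<ge>0. \<forall>x\<ge>0. \<bar>x ^ Suc (Suc d) - max 0 (x - a) ^ Suc (Suc d) - a * Suc (Suc d) * x ^ Suc d\<bar> \<le> M * (1 + x) ^ d"
proof -
  obtain M where M: "M \<ge> 0" "\<And>x. x \<ge> a \<Longrightarrow>
    \<bar>x ^ Suc (Suc d) - (x - a) ^ Suc (Suc d) - a * Suc (Suc d) * x ^ Suc d\<bar> \<le> M * (1 + x) ^ d"
    using power_diff_linear_approx[OF assms] by blast
  let ?M = "M + a ^ Suc (Suc d) + a * Suc (Suc d) * a ^ Suc d"
  show ?thesis
  proof (intro exI[of _ ?M] conjI allI impI)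
    show "0 \<le> ?M" using assms M by simp
    fix x :: real assume x: "x \<ge> 0"
    let ?N = "a ^ Suc (Suc d) + a * Suc (Suc d) * a ^ Suc d"
    have N: "?N \<ge> 0" using assms by simp
    show "\<bar>x ^ Suc (Suc d) - max 0 (x - a) ^ Suc (Suc d) - a * Suc (Suc d) * x ^ Suc d\<bar> \<le> ?M * (1 + x) ^ d"
    proof (cases "x \<ge> a")
      case True
      have "M * (1 + x) ^ d \<le> ?M * (1 + x) ^ d"
        using N x by (intro mult_right_mono) auto
      then show ?thesis using M(2)[OF True] True by (simp add: max_def)
    next
      \<comment> \<open>Below \<open>a\<close> every term is bounded by a constant, and 1 \<le> (1 +
        x)^d.\<close>
      case False
      have "x ^ Suc (Suc d) \<le> a ^ Suc (Suc d)" "x ^ Suc d \<le> a ^ Suc d"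
        using False x by (intro power_mono; simp)+
      moreover from this have "a * Suc (Suc d) * x ^ Suc d \<le> a * Suc (Suc d) * a ^ Suc d"
        using assms by (intro mult_left_mono) auto
      moreover have "0 \<le> x ^ Suc (Suc d)" "0 \<le> a * Suc (Suc d) * x ^ Suc d" using x assms by auto
      moreover have "max 0 (x - a) ^ Suc (Suc d) = 0" using False by (simp add: max_def)
      ultimately have "\<bar>x ^ Suc (Suc d) - max 0 (x - a) ^ Suc (Suc d) - a * Suc (Suc d) * x ^ Suc d\<bar> \<le> ?N"
        by linarith
      also have "\<dots> \<le> ?M * 1" using M by simp
      also have "\<dots> \<le> ?M * (1 + x) ^ d"
        using M N x by (intro mult_left_mono one_le_power) auto
      finally show ?thesis .
    qed
  qed
qed

text \<open>The new coefficients sum the old ones in steps of \<open>i\<close>, which acts like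
  integration divided by \<open>i\<close>. The monomial with the new constant satisfies the same
  recursion up to order d, so the errors accumulate to order d + 1.\<close>

lemma geo_asymp:
  assumes "asymp_monom F c d" and i: "i > 0"
  shows "asymp_monom (geo_fps i * F) (c / (i * Suc (Suc d))) (Suc d)"
proof -
  obtain K where K: "K \<ge> 0" "\<And>k. k \<ge> 0 \<Longrightarrow> \<bar>int_nth F k - c * of_int k ^ Suc d\<bar> \<le> K * (1 + of_int k) ^ d"
    using assms unfolding asymp_monom_def by blast
  obtain M where M: "M \<ge> 0" "\<And>x::real. x \<ge> 0 \<Longrightarrow>
    \<bar>x ^ Suc (Suc d) - max 0 (x - real i) ^ Suc (Suc d) - real i * Suc (Suc d) * x ^ Suc d\<bar> \<le> M * (1 + x) ^ d"
    using power_pos_part_linear_approx[of "real i" d, OF of_nat_0_le_iff] by blast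
  define c' where "c' = c / (i * Suc (Suc d))"
  let ?K = "K + \<bar>c'\<bar> * M"
  have c': "c' * (real i * Suc (Suc d) * y) = c * y" for y
  proof -
    define D where "D = real i * Suc (Suc d)"
    have "D \<noteq> 0" using i by (simp add: D_def del: of_nat_Suc)
    then show ?thesis unfolding c'_def D_def[symmetric] of_nat_mult by simp
  qed
  let ?G = "geo_fps i * F"
  have "\<bar>int_nth ?G k - c' * of_int k ^ Suc (Suc d)\<bar> \<le> ?K * (1 + of_int k) ^ Suc d" if "k \<ge> 0" for k
    using that
  proof (induction "nat k" arbitrary: k rule: less_induct)
    case less
    let ?x = "real_of_int k"
    have x: "?x \<ge> 0" using less by simp
    \<comment> \<open>The truncation makes the model vanish at negative indices, as the coefficients
      do.\<close>
    define y where "y = max 0 (?x - i)"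
    \<comment> \<open>Bounding (1 + y)^(d + 1) by x (1 + x)^d rather than by (1 + x)^(d + 1) leaves
      a surplus (1 + x)^d that pays for the errors of this step.\<close>
    have prev: "\<bar>int_nth ?G (k - int i) - c' * y ^ Suc (Suc d)\<bar> \<le> ?K * (?x * (1 + ?x) ^ d)"
    proof (cases "k - int i \<ge> 0")
      case True
      then have "\<bar>int_nth ?G (k - int i) - c' * y ^ Suc (Suc d)\<bar> \<le> ?K * (1 + y) ^ Suc d"
        using less(1)[of "k - int i"] i by (simp add: y_def max_def)
      also have "\<dots> \<le> ?K * (?x * (1 + ?x) ^ d)"
      proof -
        have "1 + y \<le> ?x" using i True by (simp add: y_def max_def)
        moreover have "y \<ge> 0" by (simp add: y_def)
        ultimately have "(1 + y) * (1 + y) ^ d \<le> ?x * (1 + ?x) ^ d"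
          by (intro mult_mono power_mono) auto
        then show ?thesis using K M by (intro mult_left_mono) auto
      qed
      finally show ?thesis .
    next
      case False
      then have "y = 0" by (simp add: y_def max_def)
      then show ?thesis using False K M x by simp
    qed
    have "\<bar>c' * (?x ^ Suc (Suc d) - y ^ Suc (Suc d) - real i * Suc (Suc d) * ?x ^ Suc d)\<bar> \<le> \<bar>c'\<bar> * (M * (1 + ?x) ^ d)"
      unfolding abs_mult y_def using M(2)[OF x] by (rule mult_left_mono) (rule abs_ge_zero)
    also have "c' * (?x ^ Suc (Suc d) - y ^ Suc (Suc d) - real i * Suc (Suc d) * ?x ^ Suc d) =
      c' * ?x ^ Suc (Suc d) - c' * y ^ Suc (Suc d) - c * ?x ^ Suc d"
      by (simp only: right_diff_distrib c')
    finally have 2: "\<bar>c' * ?x ^ Suc (Suc d) - c' * y ^ Suc (Suc d) - c * ?x ^ Suc d\<bar> \<le> \<bar>c'\<bar> * (M * (1 + ?x) ^ d)" .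
    have "?K * (1 + ?x) ^ Suc d = ?K * (?x * (1 + ?x) ^ d) + K * (1 + ?x) ^ d + \<bar>c'\<bar> * (M * (1 + ?x) ^ d)"
      by (simp add: algebra_simps)
    then show ?case
      using prev 2 K(2)[OF less(2)] int_nth_geo[OF i, of F k] by linarith
  qed
  moreover have "?K \<ge> 0" using K M by simp
  ultimately show ?thesis unfolding asymp_monom_def c'_def[symmetric] by blast
qed

lemma int_nth_geo_one:
  assumes "i > 0"
  shows "int_nth (geo_fps i) k = (if k \<ge> 0 \<and> int i dvd k then 1 else 0)"
proof (induction "nat k" arbitrary: k rule: less_induct)
  case less
  have eq: "int_nth (geo_fps i) k = (if k = 0 then 1 else 0) + int_nth (geo_fps i) (k - int i)"
    using int_nth_geo[OF assms, of 1 k] by (simp add: int_nth_one)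
  have dvd: "int i dvd k - int i \<longleftrightarrow> int i dvd k" by (metis dvd_diff dvd_refl diff_add_cancel dvd_add)
  consider "k < 0" | "k = 0" | "0 < k" "k < int i" | "k \<ge> int i" by linarith
  then show ?case
  proof cases
    case 3
    then have "\<not> int i dvd k" by (simp add: zdvd_not_zless)
    then show ?thesis using 3 eq by simp
  next
    case 4
    then show ?thesis using less[of "k - int i"] eq dvd assms by simp
  qed (use eq assms in auto)
qed

text \<open>The multiples 0, 5, ..., 25 cover each residue modulo 6 once, so the coefficient grows
  by exactly 1 when k grows by 30.\<close>

lemma int_nth_geo_5_6:
  assumes "k \<ge> 0"
  shows "\<bar>int_nth (geo_fps 5 * geo_fps 6) k - of_int k / 30\<bar> \<le> 1"
  using assms
proof (induction "nat k" arbitrary: k rule: less_induct)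
  case less
  let ?v = "int_nth (geo_fps 5 * geo_fps 6)"
  let ?w = "\<lambda>k::int. if k \<ge> 0 \<and> 6 dvd k then 1 else (0::real)"
  have step: "?v k = ?w k + ?v (k - 5)" for k
    using int_nth_geo[of 5 "geo_fps 6" k] by (simp add: int_nth_geo_one)
  have v: "?v k = ?w k + ?w (k - 5) + ?w (k - 10) + ?w (k - 15) + ?w (k - 20) + ?w (k - 25) + ?v (k - 30)"
    using step[of k] step[of "k - 5"] step[of "k - 10"] step[of "k - 15"] step[of "k - 20"] step[of "k - 25"]
    by simp
  let ?s = "?w k + ?w (k - 5) + ?w (k - 10) + ?w (k - 15) + ?w (k - 20) + ?w (k - 25)"
  have dvd: "6 dvd k \<longleftrightarrow> k mod 6 = 0" "6 dvd k - 5 \<longleftrightarrow> k mod 6 = 5" "6 dvd k - 10 \<longleftrightarrow> k mod 6 = 4"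
    "6 dvd k - 15 \<longleftrightarrow> k mod 6 = 3" "6 dvd k - 20 \<longleftrightarrow> k mod 6 = 2" "6 dvd k - 25 \<longleftrightarrow> k mod 6 = 1"
    by presburger+
  have r: "k mod 6 = 0 \<or> k mod 6 = 1 \<or> k mod 6 = 2 \<or> k mod 6 = 3 \<or> k mod 6 = 4 \<or> k mod 6 = 5"
    by presburger
  have s: "0 \<le> ?s" "?s \<le> 1"
    using r unfolding dvd by (elim disjE; simp)+
  show ?case
  proof (cases "k \<ge> 30")
    case True
    then have "?s = 1" using r unfolding dvd by (elim disjE; simp)
    then show ?thesis using v less(1)[of "k - 30"] True by (simp add: diff_divide_distrib)
  next
    case False
    then have "?v k = ?s" using v by simp
    moreover have "0 \<le> real_of_int k / 30" "real_of_int k / 30 \<le> 1" using False less(2) by simp_all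
    ultimately show ?thesis using s by linarith
  qed
qed

definition part_diff_fps :: "nat \<Rightarrow> real fps" where
  "part_diff_fps b = (1 - fps_X) * part_fps b"

lemma part_fps_Suc: "b > 0 \<Longrightarrow> part_fps (Suc b) = geo_fps (Suc b) * part_fps b"
  by (simp add: part_fps_def)

text \<open>The coprime exponents 5 and 6 make the coefficients of the second factor linear up to $O(1)$.\<close>

lemma part_diff_fps_5:
  "part_diff_fps 5 = geo_fps 4 * ((1 - fps_X + fps_X ^ 2) * (geo_fps 5 * geo_fps 6))"
proof -
  let ?X = "fps_X :: real fps"
  have g: "(1 - ?X ^ 2) * geo_fps 2 = 1" "(1 - ?X ^ 3) * geo_fps 3 = 1" "(1 - ?X ^ 6) * geo_fps 6 = 1"
    by (rule geo_fps; simp)+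
  \<comment> \<open>This identity trades the exponents 2 and 3 for the single exponent 6, at the
    price of a polynomial factor.\<close>
  have "(1 - ?X) * (1 - ?X ^ 6) = (1 - ?X + ?X ^ 2) * ((1 - ?X ^ 2) * (1 - ?X ^ 3))"
    by (simp add: algebra_simps eval_nat_numeral)
  then have "(1 - ?X) * ((1 - ?X ^ 6) * geo_fps 6) * (geo_fps 2 * geo_fps 3) =
    (1 - ?X + ?X ^ 2) * (((1 - ?X ^ 2) * geo_fps 2) * ((1 - ?X ^ 3) * geo_fps 3)) * geo_fps 6"
    by (simp only: mult.assoc[symmetric]) (simp only: mult_ac)
  then have "(1 - ?X) * (geo_fps 2 * geo_fps 3) = (1 - ?X + ?X ^ 2) * geo_fps 6"
    unfolding g by simp
  moreover have "part_fps 5 = geo_fps 2 * geo_fps 3 * geo_fps 4 * geo_fps 5"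
    by (simp add: part_fps_def eval_nat_numeral)
  ultimately show ?thesis
    unfolding part_diff_fps_def by (metis (no_types, opaque_lifting) mult.assoc mult.commute)
qed

text \<open>For b = 5 the pole at q = 1 has order 3 and every other pole at most 2; this is the
  first b where q = 1 dominates. Each further factor is then handled by
  \<open>geo_asymp\<close>.\<close>

lemma part_diff_fps_asymp: "\<exists>c>0. asymp_monom (part_diff_fps (e + 5)) c (Suc e)"
proof (induction e)
  case 0
  let ?v = "geo_fps 5 * geo_fps 6"
  let ?F = "(1 - fps_X + fps_X ^ 2) * ?v"
  \<comment> \<open>Extended to k = -1, -2, because the polynomial factor looks back by two
    indices.\<close>
  have v: "\<bar>int_nth ?v k - of_int k / 30\<bar> \<le> 1" if "k \<ge> -2" for k
  proof (cases "k \<ge> 0")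
    case False
    then have "of_int k \<ge> (-2::real)" using that by simp
    then show ?thesis using False by (simp add: abs_if)
  qed (rule int_nth_geo_5_6)
  have F: "int_nth ?F k = int_nth ?v k - int_nth ?v (k - 1) + int_nth ?v (k - 2)" for k
    using int_nth_X_power_mult[of 1 ?v k] int_nth_X_power_mult[of 2 ?v k]
    by (simp add: distrib_right left_diff_distrib int_nth_add int_nth_diff)
  \<comment> \<open>Three errors of 1, plus 1/30 because the combined main term is (k -
    1)/30.\<close>
  have "\<bar>int_nth ?F k - of_int k / 30\<bar> \<le> 4" if "k \<ge> 0" for k
    using v[of k] v[of "k - 1"] v[of "k - 2"] that unfolding F by (simp add: abs_le_iff field_simps)
  then have "asymp_monom ?F (1 / 30) 0"
    unfolding asymp_monom_def by (intro exI[of _ 4]) auto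
  from geo_asymp[OF this, of 4] show ?case
    by (intro exI[of _ "1 / 30 / (4 * 2)"]) (simp add: part_diff_fps_5)
next
  case (Suc e)
  then obtain c where c: "c > 0" "asymp_monom (part_diff_fps (e + 5)) c (Suc e)" by blast
  have "part_diff_fps (Suc e + 5) = geo_fps (e + 6) * part_diff_fps (e + 5)"
    using part_fps_Suc[of "e + 5"] by (simp add: part_diff_fps_def mult_ac add_ac)
  with geo_asymp[OF c(2), of "e + 6"] c(1) show ?case
    by (intro exI[of _ "c / ((e + 6) * Suc (Suc (Suc e)))"] conjI divide_pos_pos mult_pos_pos)
      (simp_all add: add_ac del: of_nat_mult)
qed

lemma part_fps_asymp: "\<exists>c>0. asymp_monom (part_fps (e + 5)) c (Suc (Suc e))"
proof -
  obtain c where c: "c > 0" "asymp_monom (part_diff_fps (e + 5)) c (Suc e)"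
    using part_diff_fps_asymp by blast
  have "geo_fps 1 * part_diff_fps (e + 5) = part_fps (e + 5)"
    using geo_fps[of 1] by (simp add: part_diff_fps_def mult_ac)
  with geo_asymp[OF c(2), of 1] c(1) show ?thesis
    by (intro exI[of _ "c / (1 * Suc (Suc (Suc e)))"]) simp
qed

section \<open>First differences of Gaussian binomial coefficients\<close>

definition q_binomial_diff :: "nat \<Rightarrow> nat \<Rightarrow> int \<Rightarrow> real" where
  "q_binomial_diff m b k = int_nth (top_factors m b * part_fps b) k"

text \<open>The parametrisation by n matches the staircase. For b > 0 and n + 1 = m + b these are
  the values of \<open>q_binomial_diff m b\<close> with the index shifted by b choose 2.\<close>

definition subset_sums_diff :: "nat \<Rightarrow> nat \<Rightarrow> int \<Rightarrow> real" where
  "subset_sums_diff n b l = int_nth (subset_fps (Suc n) b) l - int_nth (subset_fps (Suc n) b) (l - 1)"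

lemma int_nth_subset_fps_reflect:
  "int_nth (subset_fps (Suc n) b) (int (b * n) - l) = int_nth (subset_fps (Suc n) b) l"
proof -
  consider "l < 0" | "l > int (b * n)" | "0 \<le> l" "l \<le> int (b * n)" by linarith
  then show ?thesis
  proof cases
    case 1
    then have "b * n < nat (int (b * n) - l)" by linarith
    then show ?thesis using 1 by (simp add: int_nth_def subset_fps_def subset_sums_eq_0 del: of_nat_mult)
  next
    case 2
    then have "b * n < nat l" by linarith
    then show ?thesis using 2 by (simp add: int_nth_def subset_fps_def subset_sums_eq_0 del: of_nat_mult)
  next
    case 3
    then have "nat (int (b * n) - l) = b * n - nat l" "nat l \<le> b * n" by linarith+
    then show ?thesis using 3 by (simp add: int_nth_def subset_fps_def subset_sums_reflect del: of_nat_mult)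
  qed
qed

text \<open>A difference joins l - 1 and l; reflection swaps these two ends, which causes both the
  sign and the offset 1.\<close>

lemma subset_sums_diff_reflect: "subset_sums_diff n b (int (b * n) + 1 - l) = - subset_sums_diff n b l"
proof -
  have "int (b * n) + 1 - l = int (b * n) - (l - 1)" "int (b * n) + 1 - l - 1 = int (b * n) - l" by auto
  then show ?thesis unfolding subset_sums_diff_def by (simp only: int_nth_subset_fps_reflect)
qed

lemma subset_sums_diff_eq_q_binomial_diff:
  assumes "b > 0" "Suc n = m + b"
  shows "subset_sums_diff n b l = q_binomial_diff m b (l - int (b choose 2))"
  unfolding subset_sums_diff_def q_binomial_diff_def int_nth_one_minus_X_mult[symmetric] assms(2) subset_fps_diff[OF assms(1)]
  by (rule int_nth_X_power_mult)

lemma q_binomial_diff_reflect: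
  assumes "b > 0"
  shows "q_binomial_diff m b (int (b * m) + 1 - k) = - q_binomial_diff m b k"
proof -
  obtain c where b: "b = Suc c" using assms gr0_conv_Suc by blast
  define n where "n = m + c"
  have n: "Suc n = m + b" by (simp add: n_def b)
  have "b * n = b * m + 2 * (b choose 2)"
    by (simp add: n_def b choose_two algebra_simps)
  then have e: "int (b * m) + 1 - k = int (b * n) + 1 - (k + int (b choose 2)) - int (b choose 2)"
    by simp
  have "q_binomial_diff m b k = subset_sums_diff n b (k + int (b choose 2))"
    using subset_sums_diff_eq_q_binomial_diff[OF assms n] by simp
  then show ?thesis
    unfolding e by (simp only: subset_sums_diff_eq_q_binomial_diff[OF assms n, symmetric] subset_sums_diff_reflect)
qed

lemma q_binomial_diff_diff:
  "q_binomial_diff m b k - q_binomial_diff m b (k - 1) = int_nth (top_factors m b * part_diff_fps b) k"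
  unfolding q_binomial_diff_def part_diff_fps_def int_nth_one_minus_X_mult[symmetric] by (simp only: mult_ac)

lemma q_binomial_diff_asymp:
  "\<exists>c>0. \<exists>K\<ge>0. \<forall>m>0. \<forall>k. of_int k \<le> real (e + 5) * real m \<longrightarrow>
    \<bar>q_binomial_diff m (e + 5) k - c * real m ^ (e + 3) * spline (e + 5) (e + 3) (of_int k / real m)\<bar> \<le> K * real m ^ (e + 2)"
proof -
  obtain c where "c > 0" "asymp_monom (part_fps (e + 5)) c (Suc (Suc e))"
    using part_fps_asymp by blast
  with top_factors_asymp[OF this(2), of "real (e + 5)" "e + 5"] show ?thesis
    unfolding q_binomial_diff_def numeral_3_eq_3 numeral_2_eq_2 by (auto simp del: power_Suc)
qed

lemma q_binomial_diff_diff_asymp: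
  "\<exists>c>0. \<exists>K\<ge>0. \<forall>m>0. \<forall>k. of_int k \<le> real (e + 5) * real m \<longrightarrow>
    \<bar>q_binomial_diff m (e + 5) k - q_binomial_diff m (e + 5) (k - 1) - c * real m ^ (e + 2) * spline (e + 5) (e + 2) (of_int k / real m)\<bar>
      \<le> K * real m ^ (e + 1)"
proof -
  obtain c where "c > 0" "asymp_monom (part_diff_fps (e + 5)) c (Suc e)"
    using part_diff_fps_asymp by blast
  with top_factors_asymp[OF this(2), of "real (e + 5)" "e + 5"] show ?thesis
    unfolding q_binomial_diff_diff numeral_2_eq_2 by (auto simp del: power_Suc)
qed

text \<open>
  Here the main term of the first difference vanishes. By antisymmetry, twice the first difference
  at $k$ is minus the sum of the second differences over the interval reflected about the centre.
\<close>

lemma q_binomial_diff_near_centre: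
  "\<exists>\<epsilon>>0. \<exists>\<eta>>0. \<exists>M>0. \<forall>m\<ge>M. \<forall>k.
     real m * (real (e + 5) / 2 - \<epsilon>) \<le> of_int k \<longrightarrow> 2 * k \<le> int ((e + 5) * m) \<longrightarrow> \<eta> * real m ^ (e + 2) \<le> q_binomial_diff m (e + 5) k"
proof -
  let ?b = "e + 5"
  let ?H = "spline ?b (e + 2)"
  define z where "z = real ?b / 2"
  obtain c K where c: "c > 0" and K: "K \<ge> 0" "\<And>m k. m > 0 \<Longrightarrow> of_int k \<le> real ?b * real m \<Longrightarrow>
    \<bar>q_binomial_diff m ?b k - q_binomial_diff m ?b (k - 1) - c * real m ^ (e + 2) * ?H (of_int k / real m)\<bar> \<le> K * real m ^ (e + 1)"
    using q_binomial_diff_diff_asymp[of e] by blast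
  have "?H z < 0"
    using spline_centre_neg[of "e + 2"] by (simp add: z_def add_ac)
  define \<delta> where "\<delta> = - ?H z / 2"
  have \<delta>: "\<delta> > 0" using \<open>?H z < 0\<close> by (simp add: \<delta>_def)
  obtain \<epsilon>0 where \<epsilon>0: "\<epsilon>0 > 0" "\<And>t. \<bar>t - z\<bar> < \<epsilon>0 \<Longrightarrow> \<bar>?H t - ?H z\<bar> < \<delta>"
  proof -
    obtain s where s: "s > 0" "\<And>t. t \<noteq> z \<and> norm (t - z) < s \<Longrightarrow> norm (?H t - ?H z) < \<delta>"
      using continuous_spline[where b = ?b and d = "e + 2" and t = z, unfolded isCont_def LIM_eq] \<delta> by blast
    have "\<bar>?H t - ?H z\<bar> < \<delta>" if "\<bar>t - z\<bar> < s" for t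
      using s(2)[of t] that \<delta> by (cases "t = z") auto
    with s(1) show ?thesis using that by blast
  qed
  have H: "?H t \<le> - \<delta>" if "\<bar>t - z\<bar> < \<epsilon>0" for t
    using \<epsilon>0(2)[OF that] by (simp add: \<delta>_def abs_if split: if_splits)
  \<comment> \<open>The indices x used below satisfy z - \<epsilon> \<le> x / m \<le> z + 2 *
    \<epsilon>, so a third of \<open>\<epsilon>0\<close> suffices; the cap 1 keeps z - \<epsilon>
    positive.\<close>
  define \<epsilon> where "\<epsilon> = min (\<epsilon>0 / 3) 1"
  define \<eta> where "\<eta> = c * \<delta> / 2"
  have \<epsilon>: "\<epsilon> > 0" and \<eta>: "\<eta> > 0" using \<epsilon>0 c \<delta> by (simp_all add: \<epsilon>_def \<eta>_def)
  \<comment> \<open>The first bound absorbs the offset 1 of the reflection, the second makes the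
    error at most half of the main term.\<close>
  define M where "M = nat \<lceil>max (max (1 / \<epsilon>) (K / \<eta>)) 1\<rceil>"
  have "\<eta> / 2 * real m ^ (e + 2) \<le> q_binomial_diff m ?b k"
    if m: "m \<ge> M" and k: "real m * (z - \<epsilon>) \<le> of_int k" "2 * k \<le> int (?b * m)" for m k
  proof -
    have "real m \<ge> max (max (1 / \<epsilon>) (K / \<eta>)) 1" using m unfolding M_def by linarith
    then have "1 / \<epsilon> \<le> real m" "K / \<eta> \<le> real m" and m1: "1 \<le> real m" by auto
    then have m2: "1 \<le> \<epsilon> * real m" "K \<le> \<eta> * real m"
      using \<epsilon> \<eta> by (simp_all add: field_simps)
    have decr: "q_binomial_diff m ?b x - q_binomial_diff m ?b (x - 1) \<le> - (\<eta> * real m ^ (e + 2))"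
      if x: "k < x" "x \<le> int (?b * m) + 1 - k" for x
    proof -
      have r: "real_of_int x \<le> 2 * z * real m + 1 - of_int k"
      proof -
        have "real_of_int x \<le> real_of_int (int (?b * m) + 1 - k)"
          using x(2) by (simp only: of_int_le_iff)
        moreover have "2 * z = real ?b" by (simp add: z_def)
        ultimately show ?thesis
          by (simp only: of_int_diff of_int_add of_int_1 of_int_of_nat_eq of_nat_mult of_int_mult)
      qed
      then have u: "real_of_int x \<le> real m * (z + 2 * \<epsilon>)"
        using k(1) m2(1) by (simp add: algebra_simps)
      have "real_of_int x \<ge> real m * (z - \<epsilon>)" using x(1) k(1) by linarith
      with u m1 have "z - \<epsilon> \<le> of_int x / real m" "of_int x / real m \<le> z + 2 * \<epsilon>"
        by (simp_all add: field_simps)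
      then have "?H (of_int x / real m) \<le> - \<delta>"
        using \<epsilon> \<epsilon>0(1) by (intro H) (simp add: \<epsilon>_def abs_if min_def split: if_splits)
      then have "c * real m ^ (e + 2) * ?H (of_int x / real m) \<le> c * real m ^ (e + 2) * (- \<delta>)"
        using c by (intro mult_left_mono) auto
      also have "\<dots> = - 2 * (\<eta> * real m ^ (e + 2))" by (simp add: \<eta>_def)
      finally have 1: "c * real m ^ (e + 2) * ?H (of_int x / real m) \<le> - 2 * (\<eta> * real m ^ (e + 2))" .
      have "K * real m ^ (e + 1) \<le> \<eta> * real m * real m ^ (e + 1)"
        using m2 by (intro mult_right_mono) auto
      then have 2: "K * real m ^ (e + 1) \<le> \<eta> * real m ^ (e + 2)" by (simp add: mult_ac)
      have "x \<le> int (?b * m)"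
      proof -
        have "0 < z - \<epsilon>" by (simp add: z_def \<epsilon>_def)
        then have "0 < real m * (z - \<epsilon>)" using m1 by simp
        then have "0 < k" using k(1) by linarith
        then show ?thesis using x(2) by linarith
      qed
      then have "real_of_int x \<le> real_of_int (int (?b * m))" by (simp only: of_int_le_iff)
      then have "real_of_int x \<le> real ?b * real m" by (simp only: of_int_of_nat_eq of_nat_mult of_int_mult)
      moreover have "m > 0" using m1 by simp
      ultimately show ?thesis using K(2)[of m x] 1 2 by linarith
    qed
    \<comment> \<open>All second differences in the interval are negative; keeping the first and
      dropping the others already gives the right order.\<close>
    have chain: "k + 1 + int j \<le> int (?b * m) + 1 - k \<Longrightarrow>
      q_binomial_diff m ?b (k + 1 + int j) \<le> q_binomial_diff m ?b k - \<eta> * real m ^ (e + 2)" for j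
    proof (induction j)
      case 0
      then show ?case using decr[of "k + 1"] by simp
    next
      case (Suc j)
      have "0 \<le> \<eta> * real m ^ (e + 2)" using \<eta> by simp
      moreover have e: "k + 1 + int (Suc j) - 1 = k + 1 + int j" by simp
      moreover have "k + 1 + int j \<le> int (?b * m) + 1 - k" using Suc.prems by linarith
      note Suc.IH[OF this]
      moreover have "q_binomial_diff m ?b (k + 1 + int (Suc j)) - q_binomial_diff m ?b (k + 1 + int j) \<le> - (\<eta> * real m ^ (e + 2))"
        using decr[OF _ Suc.prems] unfolding e by simp
      ultimately show ?case by linarith
    qed
    \<comment> \<open>With this \<open>j\<close> the chain ends at the mirror image of k, where the
      difference is minus that at k. Solving for it halves the constant.\<close>
    define j where "j = nat (int (?b * m) - 2 * k)"
    have e: "k + 1 + int j = int (?b * m) + 1 - k" using k(2) unfolding j_def by linarith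
    have "q_binomial_diff m ?b (int (?b * m) + 1 - k) \<le> q_binomial_diff m ?b k - \<eta> * real m ^ (e + 2)"
      using chain[of j, unfolded e, OF order_refl] .
    then show ?thesis using q_binomial_diff_reflect[of ?b m k] by linarith
  qed
  moreover have "M > 0" unfolding M_def by linarith
  ultimately show ?thesis
    using \<epsilon> \<eta> unfolding z_def by (intro exI[of _ \<epsilon>] conjI exI[of _ "\<eta> / 2"] exI[of _ M]) auto
qed

text \<open>On the compact interval [1, z - \<epsilon>] the spline has a positive minimum, so the
  main term of order e + 3 beats its error. Indices below m are left to
  \<open>q_binomial_diff_small\<close>.\<close>

lemma q_binomial_diff_away_from_centre:
  assumes "\<epsilon> > 0"
  shows "\<exists>M>0. \<forall>m\<ge>M. \<forall>k. int m \<le> k \<longrightarrow> of_int k \<le> real m * (real (e + 5) / 2 - \<epsilon>) \<longrightarrow>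
    real m ^ (e + 2) \<le> q_binomial_diff m (e + 5) k"
proof -
  let ?b = "e + 5"
  let ?G = "spline ?b (e + 3)"
  define z where "z = real ?b / 2"
  obtain c K where c: "c > 0" and K: "K \<ge> 0" "\<And>m k. m > 0 \<Longrightarrow> of_int k \<le> real ?b * real m \<Longrightarrow>
    \<bar>q_binomial_diff m ?b k - c * real m ^ (e + 3) * ?G (of_int k / real m)\<bar> \<le> K * real m ^ (e + 2)"
    using q_binomial_diff_asymp[of e] by blast
  obtain \<gamma> where \<gamma>: "\<gamma> > 0" "\<And>t. 1 \<le> t \<Longrightarrow> t \<le> z - \<epsilon> \<Longrightarrow> \<gamma> \<le> ?G t"
  proof (cases "1 \<le> z - \<epsilon>")
    case True
    have "\<forall>t. 1 \<le> t \<and> t \<le> z - \<epsilon> \<longrightarrow> isCont ?G t" by (simp add: continuous_spline)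
    from isCont_eq_Lb[OF True this] obtain t where t: "1 \<le> t" "t \<le> z - \<epsilon>"
      "\<And>x. 1 \<le> x \<Longrightarrow> x \<le> z - \<epsilon> \<Longrightarrow> ?G t \<le> ?G x" by blast
    have "2 * t < real (Suc (Suc (e + 3)))" using t(2) assms unfolding z_def by (simp only: of_nat_add of_nat_Suc) (simp add: field_simps)
    then have "?G t > 0"
      using spline_pos[of "e + 3" t] t(1) by (simp add: eval_nat_numeral)
    then show ?thesis using t that by blast
  next
    case False
    then show ?thesis by (intro that[of 1]) auto
  qed
  \<comment> \<open>This gives c * m * \<gamma> \<ge> K + 1: K for the error and 1 for the claimed
    bound.\<close>
  define M where "M = nat \<lceil>max ((K + 1) / (c * \<gamma>)) 1\<rceil>"
  have "real m ^ (e + 2) \<le> q_binomial_diff m ?b k"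
    if m: "m \<ge> M" and k: "int m \<le> k" "of_int k \<le> real m * (z - \<epsilon>)" for m k
  proof -
    have "real m \<ge> max ((K + 1) / (c * \<gamma>)) 1" using m unfolding M_def by linarith
    then have "(K + 1) / (c * \<gamma>) \<le> real m" and m1: "1 \<le> real m" by auto
    then have m2: "K + 1 \<le> c * real m * \<gamma>"
      using c \<gamma>(1) by (simp add: field_simps)
    have kb: "of_int k \<le> real ?b * real m"
    proof -
      have "real m * (z - \<epsilon>) \<le> real m * real ?b"
      proof (rule mult_left_mono)
        have "0 \<le> z" "real ?b = 2 * z" by (simp_all add: z_def)
        then show "z - \<epsilon> \<le> real ?b" using assms by linarith
      qed simp
      then show ?thesis using k(2) by (simp add: mult.commute)
    qed
    have m0: "m > 0" using m1 by simp
    have "1 \<le> of_int k / real m" "of_int k / real m \<le> z - \<epsilon>"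
      using k m1 by (simp_all add: field_simps)
    then have "c * real m ^ (e + 3) * \<gamma> \<le> c * real m ^ (e + 3) * ?G (of_int k / real m)"
      using c by (intro mult_left_mono \<gamma>) auto
    moreover have "(K + 1) * real m ^ (e + 2) \<le> (c * real m * \<gamma>) * real m ^ (e + 2)"
      using m2 by (intro mult_right_mono) auto
    moreover have "(c * real m * \<gamma>) * real m ^ (e + 2) = c * real m ^ (e + 3) * \<gamma>"
      by (simp add: eval_nat_numeral)
    moreover have "c * real m ^ (e + 3) * ?G (of_int k / real m) - q_binomial_diff m ?b k \<le> K * real m ^ (e + 2)"
      using K(2)[OF m0 kb] by linarith
    moreover have "(K + 1) * real m ^ (e + 2) = K * real m ^ (e + 2) + real m ^ (e + 2)"
      by (simp only: distrib_right mult_1)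
    ultimately show ?thesis by linarith
  qed
  moreover have "M > 0" unfolding M_def by linarith
  ultimately show ?thesis unfolding z_def by (intro exI[of _ M]) auto
qed

text \<open>Near and away from the centre the differences are at least of order m^(e + 2), which
  exceeds any multiple \<open>C\<close> of m^(e + 1). The constant is chosen later from the bound on
  the smaller staircase.\<close>

lemma q_binomial_diff_lower_bound:
  "\<exists>M>0. \<forall>m\<ge>M. \<forall>k. int m \<le> k \<longrightarrow> 2 * k \<le> int ((e + 5) * m) \<longrightarrow>
    C * real m ^ (e + 1) \<le> q_binomial_diff m (e + 5) k"
proof -
  obtain \<epsilon> \<eta> M1 where \<epsilon>: "\<epsilon> > 0" and \<eta>: "\<eta> > 0" and M1: "M1 > 0" "\<And>m k. m \<ge> M1 \<Longrightarrow>
     real m * (real (e + 5) / 2 - \<epsilon>) \<le> of_int k \<Longrightarrow> 2 * k \<le> int ((e + 5) * m) \<Longrightarrow> \<eta> * real m ^ (e + 2) \<le> q_binomial_diff m (e + 5) k"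
    using q_binomial_diff_near_centre[of e] by blast
  obtain M2 where M2: "\<And>m k. m \<ge> M2 \<Longrightarrow> int m \<le> k \<Longrightarrow> of_int k \<le> real m * (real (e + 5) / 2 - \<epsilon>) \<Longrightarrow>
    real m ^ (e + 2) \<le> q_binomial_diff m (e + 5) k"
    using q_binomial_diff_away_from_centre[OF \<epsilon>, of e] by blast
  define M where "M = max (max M1 M2) (nat \<lceil>max C (C / \<eta>)\<rceil>)"
  have "C * real m ^ (e + 1) \<le> q_binomial_diff m (e + 5) k"
    if m: "m \<ge> M" and k: "int m \<le> k" "2 * k \<le> int ((e + 5) * m)" for m k
  proof -
    have "real m \<ge> max C (C / \<eta>)" using m unfolding M_def by linarith
    then have m1: "C \<le> real m" "C \<le> \<eta> * real m" using \<eta> by (simp_all add: field_simps)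
    have "C * real m ^ (e + 1) \<le> real m * real m ^ (e + 1)" "C * real m ^ (e + 1) \<le> \<eta> * real m * real m ^ (e + 1)"
      using m1 by (intro mult_right_mono; simp)+
    then have "C * real m ^ (e + 1) \<le> real m ^ (e + 2)" "C * real m ^ (e + 1) \<le> \<eta> * real m ^ (e + 2)"
      by (simp_all add: mult_ac)
    moreover have "m \<ge> M1" "m \<ge> M2" using m by (auto simp: M_def)
    ultimately show ?thesis using M1(2)[of m k] M2[of m k] k by linarith
  qed
  moreover have "M > 0" using M1 by (simp add: M_def)
  ultimately show ?thesis by blast
qed

section \<open>Bounds and induction on the number of rows\<close>

text \<open>Every numerator factor shifts by more than m, hence to a negative index.\<close>

lemma int_nth_top_factors_small: "k \<le> int m \<Longrightarrow> int_nth (top_factors m j * F) k = int_nth F k"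
  by (induction j) (simp_all add: int_nth_top_factors_0 int_nth_top_factors_Suc)

text \<open>Two distinct numerator factors together shift by at least 2 * m + 3, so only the linear
  terms of the product contribute.\<close>

lemma int_nth_top_factors_medium:
  "k \<le> 2 * int m + 2 \<Longrightarrow> int_nth (top_factors m j * F) k = int_nth F k - (\<Sum>i=1..j. int_nth F (k - int m - int i))"
proof (induction j)
  case 0
  then show ?case by (simp add: int_nth_top_factors_0)
next
  case (Suc j)
  have "int_nth (top_factors m j * F) (k - int (m + Suc j)) = int_nth F (k - int (m + Suc j))"
    \<comment> \<open>The shifted index is at most m once j \<ge> 1; for j = 0 it may be m + 1, but
      no factor is present.\<close>
    using Suc.prems by (cases "j = 0") (simp add: int_nth_top_factors_0, intro int_nth_top_factors_small, simp)
  then show ?case using Suc unfolding int_nth_top_factors_Suc by (simp add: diff_diff_eq add_ac)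
qed

lemma int_nth_geo_nonneg:
  assumes "\<And>k. int_nth F k \<ge> 0" "i > 0"
  shows "int_nth (geo_fps i * F) k \<ge> 0"
proof (induction "nat k" arbitrary: k rule: less_induct)
  case less
  show ?case
  proof (cases "k \<ge> 0")
    case True
    have "int_nth (geo_fps i * F) (k - int i) \<ge> 0"
      using less[of "k - int i"] True assms(2) by (cases "k - int i \<ge> 0") auto
    then show ?thesis using assms(1)[of k] int_nth_geo[OF assms(2), of F k] by simp
  qed simp
qed

lemma int_nth_geo_bound:
  assumes "\<And>k. k \<ge> 0 \<Longrightarrow> \<bar>int_nth F k\<bar> \<le> (1 + of_int k) ^ d" "i > 0" "k \<ge> 0"
  shows "\<bar>int_nth (geo_fps i * F) k\<bar> \<le> (1 + of_int k) ^ Suc d"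
  using assms(3)
proof (induction "nat k" arbitrary: k rule: less_induct)
  case less
  let ?x = "real_of_int k"
  have x: "0 \<le> ?x" using less by simp
  have "\<bar>int_nth (geo_fps i * F) (k - int i)\<bar> \<le> ?x * (1 + ?x) ^ d"
  proof (cases "k - int i \<ge> 0")
    case True
    then have "\<bar>int_nth (geo_fps i * F) (k - int i)\<bar> \<le> (1 + of_int (k - int i)) ^ Suc d"
      using less(1)[of "k - int i"] assms(2) by simp
    also have "\<dots> \<le> ?x * (1 + ?x) ^ d"
      using True assms(2) unfolding power_Suc by (intro mult_mono power_mono) auto
    finally show ?thesis .
  qed (use x in simp)
  then show ?case
    using assms(1)[OF less(2)] int_nth_geo[OF assms(2), of F k] by (simp add: algebra_simps abs_le_iff)
qed

lemma part_fps_nonneg: "int_nth (part_fps b) k \<ge> 0"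
proof (induction b arbitrary: k)
  case 0
  show ?case by (simp add: part_fps_def int_nth_one)
next
  case (Suc b)
  then show ?case
    by (cases "b = 0") (simp add: part_fps_def int_nth_one, simp add: part_fps_Suc int_nth_geo_nonneg)
qed

lemma part_fps_2: "part_fps 2 = geo_fps 2"
  by (simp add: part_fps_def)

text \<open>For b = 2 the coefficients are 0 and 1, and each further factor raises the degree by
  one. For b < 2 the series is 1 and the truncated exponent is 0.\<close>

lemma part_fps_bound: "k \<ge> 0 \<Longrightarrow> \<bar>int_nth (part_fps b) k\<bar> \<le> (1 + of_int k) ^ (b - 2)"
proof (induction b arbitrary: k)
  case 0
  then show ?case by (simp add: part_fps_def int_nth_one)
next
  case (Suc b)
  consider "b = 0" | "b = 1" | "b \<ge> 2" by linarith
  then show ?case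
  proof cases
    case 1
    then show ?thesis by (simp add: part_fps_def int_nth_one)
  next
    case 2
    then show ?thesis using part_fps_2 by (simp add: numeral_2_eq_2 int_nth_geo_one)
  next
    case 3
    then have e: "Suc b - 2 = Suc (b - 2)" by simp
    show ?thesis
      using int_nth_geo_bound[OF Suc.IH, of "Suc b" k] Suc.prems 3
      unfolding e by (simp add: part_fps_Suc del: power_Suc)
  qed
qed

lemma int_nth_top_factors_bound:
  assumes "\<And>x. x \<le> k \<Longrightarrow> \<bar>int_nth F x\<bar> \<le> B"
  shows "\<bar>int_nth (top_factors m j * F) k\<bar> \<le> 2 ^ j * B"
  using assms
proof (induction j arbitrary: k)
  case 0
  then show ?case by (simp add: int_nth_top_factors_0)
next
  case (Suc j)
  have "\<bar>int_nth (top_factors m j * F) k\<bar> \<le> 2 ^ j * B" "\<bar>int_nth (top_factors m j * F) (k - int (m + Suc j))\<bar> \<le> 2 ^ j * B"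
    using Suc.prems by (intro Suc.IH; simp)+
  then show ?case unfolding int_nth_top_factors_Suc by (simp add: abs_le_iff)
qed

lemma q_binomial_diff_bound:
  assumes "of_int k \<le> B" "B \<ge> 0"
  shows "\<bar>q_binomial_diff m b k\<bar> \<le> 2 ^ b * (1 + B) ^ (b - 2)"
  unfolding q_binomial_diff_def
proof (rule int_nth_top_factors_bound)
  fix x assume x: "x \<le> k"
  show "\<bar>int_nth (part_fps b) x\<bar> \<le> (1 + B) ^ (b - 2)"
  proof (cases "x \<ge> 0")
    case True
    have "\<bar>int_nth (part_fps b) x\<bar> \<le> (1 + of_int x) ^ (b - 2)" using True by (rule part_fps_bound)
    also have "\<dots> \<le> (1 + B) ^ (b - 2)"
      using True x assms by (intro power_mono) (auto simp flip: of_int_le_iff)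
    finally show ?thesis .
  qed (use assms in simp)
qed

lemma subset_sums_diff_0: "subset_sums_diff n 0 l = (if l = 0 then 1 else if l = 1 then -1 else 0)"
  by (simp add: subset_sums_diff_def subset_fps_0 int_nth_one)

lemma subset_sums_diff_1: "subset_sums_diff n 1 l = (if l = 0 then 1 else if l = int n + 1 then -1 else 0)"
proof -
  have "subset_sums_diff n 1 l = q_binomial_diff n 1 (l - int (1 choose 2))"
    by (rule subset_sums_diff_eq_q_binomial_diff) auto
  moreover have "part_fps 1 = 1" "(Suc 0 choose 2) = 0"
    by (simp_all add: part_fps_def binomial_eq_0)
  ultimately have "subset_sums_diff n 1 l = int_nth (top_factors n (Suc 0) * 1) l"
    by (simp add: q_binomial_diff_def)
  also have "\<dots> = int_nth 1 l - int_nth 1 (l - int (n + Suc 0))"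
    by (simp only: int_nth_top_factors_Suc int_nth_top_factors_0)
  finally show ?thesis by (simp add: int_nth_one)
qed

lemma subset_sums_diff_bound:
  "\<exists>K\<ge>0. \<forall>n>b. \<forall>l. l \<le> int (A * n) \<longrightarrow> \<bar>subset_sums_diff n b l\<bar> \<le> K * real n ^ (b - 2)"
proof (cases "b = 0")
  case True
  then show ?thesis by (intro exI[of _ 1]) (auto simp: subset_sums_diff_0)
next
  case False
  show ?thesis
  proof (intro exI[of _ "2 ^ b * (1 + real A) ^ (b - 2)"] conjI allI impI)
    fix n l assume n: "n > b" and l: "l \<le> int (A * n)"
    have "Suc n = (Suc n - b) + b" using n by simp
    with False have "subset_sums_diff n b l = q_binomial_diff (Suc n - b) b (l - int (b choose 2))"
      by (intro subset_sums_diff_eq_q_binomial_diff) auto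
    moreover have "real_of_int (l - int (b choose 2)) \<le> real_of_int (int (A * n))"
      unfolding of_int_le_iff using l by linarith
    ultimately have "\<bar>subset_sums_diff n b l\<bar> \<le> 2 ^ b * (1 + real A * real n) ^ (b - 2)"
      using q_binomial_diff_bound[of "l - int (b choose 2)" "real A * real n" "Suc n - b" b] by simp
    also have "\<dots> \<le> 2 ^ b * ((1 + real A) * real n) ^ (b - 2)"
      using n by (intro mult_left_mono power_mono) (auto simp: algebra_simps)
    finally show "\<bar>subset_sums_diff n b l\<bar> \<le> 2 ^ b * (1 + real A) ^ (b - 2) * real n ^ (b - 2)"
      by (simp add: power_mult_distrib mult_ac)
  qed auto
qed

section \<open>Differences of the rank numbers and the step by two rows\<close>

definition num_partitions_diff :: "nat \<Rightarrow> nat \<Rightarrow> int \<Rightarrow> real" where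
  "num_partitions_diff n b l = (let F = Abs_fps (\<lambda>l. real (num_partitions_inside (truncated_staircase n b) l))
     in int_nth F l - int_nth F (l - 1))"

lemma num_partitions_diff_0: "num_partitions_diff n 0 l = (if l = 0 then 1 else if l = 1 then -1 else 0)"
  by (simp add: num_partitions_diff_def int_nth_def num_partitions_0 Let_def)

lemma num_partitions_diff_1: "num_partitions_diff n 1 l = subset_sums_diff n 1 l"
  by (simp add: num_partitions_diff_def subset_sums_diff_def num_partitions_1[unfolded One_nat_def] subset_fps_def Let_def)

lemma num_partitions_diff_step: "num_partitions_diff n (Suc (Suc b)) l = num_partitions_diff n b l + subset_sums_diff n (Suc (Suc b)) l"
  by (simp add: num_partitions_diff_def subset_sums_diff_def subset_fps_def num_partitions_step int_nth_def)

lemma num_partitions_diff_bound: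
  "\<exists>K\<ge>0. \<forall>n>b. \<forall>l. l \<le> int (A * n) \<longrightarrow> \<bar>num_partitions_diff n b l\<bar> \<le> K * real n ^ (b - 2)"
proof (induction b rule: induct_nat_012)
  case 0
  show ?case by (intro exI[of _ 1]) (auto simp: num_partitions_diff_0)
next
  case 1
  show ?case
    using subset_sums_diff_bound[of 1 A] num_partitions_diff_1 by simp
next
  case (ge2 b)
  then obtain K1 where K1: "K1 \<ge> 0"
    "\<And>n l. n > b \<Longrightarrow> l \<le> int (A * n) \<Longrightarrow> \<bar>num_partitions_diff n b l\<bar> \<le> K1 * real n ^ (b - 2)" by blast
  obtain K2 where K2: "K2 \<ge> 0"
    "\<And>n l. n > Suc (Suc b) \<Longrightarrow> l \<le> int (A * n) \<Longrightarrow> \<bar>subset_sums_diff n (Suc (Suc b)) l\<bar> \<le> K2 * real n ^ (Suc (Suc b) - 2)"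
    using subset_sums_diff_bound[of "Suc (Suc b)" A] by blast
  show ?case
  proof (intro exI[of _ "K1 + K2"] conjI allI impI)
    fix n l assume n: "n > Suc (Suc b)" and l: "l \<le> int (A * n)"
    have "\<bar>num_partitions_diff n b l\<bar> \<le> K1 * real n ^ (b - 2)" using K1(2)[of n l] n l by simp
    also have "\<dots> \<le> K1 * real n ^ b"
      using K1(1) n by (intro mult_left_mono power_increasing) auto
    finally show "\<bar>num_partitions_diff n (Suc (Suc b)) l\<bar> \<le> (K1 + K2) * real n ^ (Suc (Suc b) - 2)"
      using K2(2)[OF n l] unfolding num_partitions_diff_step by (simp add: distrib_right)
  qed (use K1 K2 in simp)
qed

text \<open>Stronger than unimodality: the turning point is fixed at b * n / 2, so that the
  induction can compare it with the centre of the symmetric summand.\<close>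

definition peaked :: "nat \<Rightarrow> nat \<Rightarrow> bool" where
  "peaked n b \<longleftrightarrow> (\<forall>l. (2 * l \<le> int (b * n) \<longrightarrow> 0 \<le> num_partitions_diff n b l) \<and> (int (b * n) < 2 * l \<longrightarrow> num_partitions_diff n b l \<le> 0))"

lemma peaked_imp_unimodal:
  assumes "peaked n b"
  shows "unimodal (rank_gen_poly (truncated_staircase n b))"
proof -
  let ?c = "num_partitions_inside (truncated_staircase n b)"
  have d: "num_partitions_diff n b (int (Suc i)) = real (?c (Suc i)) - real (?c i)" for i
    by (simp add: num_partitions_diff_def int_nth_def nat_add_distrib)
  show ?thesis
    unfolding unimodal_def coeff_rank_gen_poly
  proof (intro exI[of _ "b * n div 2"] conjI allI impI)
    fix i assume "i < b * n div 2"
    moreover have "i < p div 2 \<Longrightarrow> 2 * int (Suc i) \<le> int p" for p by arith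
    ultimately have "2 * int (Suc i) \<le> int (b * n)" by blast
    then have "0 \<le> num_partitions_diff n b (int (Suc i))" using assms unfolding peaked_def by blast
    then show "?c i \<le> ?c (Suc i)" unfolding d by simp
  next
    fix i assume "b * n div 2 \<le> i"
    moreover have "p div 2 \<le> i \<Longrightarrow> int p < 2 * int (Suc i)" for p by arith
    ultimately have "int (b * n) < 2 * int (Suc i)" by blast
    then have "num_partitions_diff n b (int (Suc i)) \<le> 0" using assms unfolding peaked_def by blast
    then show "?c (Suc i) \<le> ?c i" unfolding d by simp
  qed
qed

text \<open>Up to b * n / 2 both summands rise, and beyond (b + 2) * n / 2 both fall, the second one
  by reflection. Only between the two centres does the fall of one compete with the rise of the
  other.\<close>

lemma peaked_step:
  assumes b: "peaked n b"
    and rise: "\<And>l. 2 * l \<le> int (Suc (Suc b) * n) \<Longrightarrow> 0 \<le> subset_sums_diff n (Suc (Suc b)) l"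
    and dominate: "\<And>l. int (b * n) < 2 * l \<Longrightarrow> 2 * l \<le> int (Suc (Suc b) * n) \<Longrightarrow>
      0 \<le> num_partitions_diff n b l + subset_sums_diff n (Suc (Suc b)) l"
  shows "peaked n (Suc (Suc b))"
  unfolding peaked_def num_partitions_diff_step
proof (intro allI conjI impI)
  fix l assume l: "2 * l \<le> int (Suc (Suc b) * n)"
  show "0 \<le> num_partitions_diff n b l + subset_sums_diff n (Suc (Suc b)) l"
  proof (cases "2 * l \<le> int (b * n)")
    case True
    then have "0 \<le> num_partitions_diff n b l" using b unfolding peaked_def by blast
    then show ?thesis using rise[OF l] by simp
  next
    case False
    then show ?thesis using dominate l by simp
  qed
next
  fix l assume l: "int (Suc (Suc b) * n) < 2 * l"
  define a where "a = int (Suc (Suc b) * n)"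
  have refl: "subset_sums_diff n (Suc (Suc b)) (a + 1 - l) = - subset_sums_diff n (Suc (Suc b)) l" for l
    unfolding a_def by (rule subset_sums_diff_reflect)
  have "subset_sums_diff n (Suc (Suc b)) l \<le> 0"
  \<comment> \<open>At this index the difference is its own negative, hence 0; any larger l reflects
    into the rising half.\<close>
  proof (cases "2 * l = a + 1")
    case True
    then have "a + 1 - l = l" by simp
    then show ?thesis using refl[of l] by simp
  next
    case False
    then have "a + 2 \<le> 2 * l" using l unfolding a_def[symmetric] by linarith
    then have "2 * (a + 1 - l) \<le> a" by (simp add: algebra_simps)
    then have "0 \<le> subset_sums_diff n (Suc (Suc b)) (a + 1 - l)"
      unfolding a_def by (rule rise)
    then show ?thesis using refl[of l] by simp
  qed
  moreover have "int (b * n) < 2 * l" using l by simp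
  then have "num_partitions_diff n b l \<le> 0" using b unfolding peaked_def by blast
  ultimately show "num_partitions_diff n b l + subset_sums_diff n (Suc (Suc b)) l \<le> 0" by simp
qed

lemma peaked_0: "peaked n 0"
  by (auto simp: peaked_def num_partitions_diff_0)

lemma peaked_1: "peaked n 1"
  by (auto simp: peaked_def num_partitions_diff_1[unfolded One_nat_def] subset_sums_diff_1[unfolded One_nat_def])

lemma q_binomial_diff_small: "k \<le> int m \<Longrightarrow> q_binomial_diff m b k = int_nth (part_fps b) k"
  by (simp add: q_binomial_diff_def int_nth_top_factors_small)

lemma peaked_2:
  assumes "n > 0"
  shows "peaked n 2"
proof -
  have s: "subset_sums_diff n 2 l = q_binomial_diff (n - 1) 2 (l - 1)" for l
    using assms subset_sums_diff_eq_q_binomial_diff[of 2 n "n - 1" l] by simp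
  have p: "int_nth (part_fps 2) k \<ge> 0" for k by (rule part_fps_nonneg)
  have "peaked n (Suc (Suc 0))"
  proof (rule peaked_step[OF peaked_0])
    fix l assume "2 * l \<le> int (Suc (Suc 0) * n)"
    then have l: "l - 1 \<le> int (n - 1)" using assms by simp
    then have e: "subset_sums_diff n 2 l = int_nth (part_fps 2) (l - 1)" by (simp add: s q_binomial_diff_small)
    then show "0 \<le> subset_sums_diff n (Suc (Suc 0)) l" using p by (simp add: numeral_2_eq_2)
    show "0 \<le> num_partitions_diff n 0 l + subset_sums_diff n (Suc (Suc 0)) l"
    \<comment> \<open>The only fall for b = 0 is the -1 at l = 1; it is cancelled by the constant
      coefficient 1 of \<open>part_fps 2\<close>.\<close>
    proof (cases "l = 1")
      case True
      then show ?thesis using e by (simp add: num_partitions_diff_0 part_fps_2 int_nth_geo_one numeral_2_eq_2[symmetric])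
    next
      case False
      then show ?thesis using e p by (simp add: num_partitions_diff_0 numeral_2_eq_2[symmetric])
    qed
  qed
  then show ?thesis by (simp add: numeral_2_eq_2)
qed

text \<open>With e + 3 rows the differences are O(n^(e + 1)), and n \<le> 2 * m turns this into the
  constant K * 2^(e + 1) in terms of m, which the lower bound for e + 5 exceeds.\<close>

lemma peaked_large_step:
  assumes "\<exists>N. \<forall>n\<ge>N. peaked n (e + 3)"
  shows "\<exists>N. \<forall>n\<ge>N. peaked n (e + 5)"
proof -
  obtain N where N: "\<And>n. n \<ge> N \<Longrightarrow> peaked n (e + 3)" using assms by blast
  let ?b = "e + 5"
  obtain K where K: "K \<ge> 0" "\<And>n l. n > e + 3 \<Longrightarrow> l \<le> int (?b * n) \<Longrightarrow>
    \<bar>num_partitions_diff n (e + 3) l\<bar> \<le> K * real n ^ (e + 3 - 2)"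
    using num_partitions_diff_bound[of "e + 3" ?b] by blast
  obtain M where M: "\<And>m k. m \<ge> M \<Longrightarrow> int m \<le> k \<Longrightarrow> 2 * k \<le> int (?b * m) \<Longrightarrow>
    K * 2 ^ (e + 1) * real m ^ (e + 1) \<le> q_binomial_diff m ?b k"
    using q_binomial_diff_lower_bound[of e "K * 2 ^ (e + 1)"] by blast
  \<comment> \<open>\<open>N\<close> serves the induction hypothesis, \<open>M\<close> the lower
    bound, and the square makes the index shift b choose 2 negligible against m.\<close>
  have "peaked n ?b" if n: "n \<ge> N + M + ?b * ?b + ?b" for n
  proof -
    define m where "m = Suc n - ?b"
    have m: "Suc n = m + ?b" "m \<ge> M" "m \<ge> ?b * ?b" using n by (auto simp: m_def)
    have s: "subset_sums_diff n ?b l = q_binomial_diff m ?b (l - int (?b choose 2))" for l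
      using m(1) by (intro subset_sums_diff_eq_q_binomial_diff) auto
    have "2 * (?b choose 2) = ?b * (e + 4)" by (simp add: choose_two)
    then have "int (2 * (?b choose 2)) = int (?b * (e + 4))" by (simp only:)
    then have ch: "2 * int (?b choose 2) = int ?b * (int ?b - 1)" by (simp add: algebra_simps)
    have bm: "int (?b * n) = int (?b * m) + 2 * int (?b choose 2)"
    proof -
      have "int n = int m + int ?b - 1" using m(1) by linarith
      then show ?thesis unfolding ch of_nat_mult by (simp add: algebra_simps)
    qed
    have Suc: "e + 5 = Suc (Suc (e + 3))" by simp
    have "peaked n (Suc (Suc (e + 3)))"
    proof (rule peaked_step[OF N], unfold Suc[symmetric])
      show "n \<ge> N" using n by simp
    next
      fix l assume l: "2 * l \<le> int (?b * n)"
      define k where "k = l - int (?b choose 2)"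
      have k: "2 * k \<le> int (?b * m)" using l bm by (simp add: k_def)
      have pos: "0 \<le> K * 2 ^ (e + 1) * real m ^ (e + 1)" using K by simp
      show "0 \<le> subset_sums_diff n ?b l"
      proof (cases "k \<le> int m")
        case True
        then show ?thesis by (simp add: s q_binomial_diff_small part_fps_nonneg flip: k_def)
      next
        case False
        then show ?thesis using M[OF m(2) _ k] pos unfolding s k_def[symmetric] by linarith
      qed
      assume l3: "int ((e + 3) * n) < 2 * l"
      \<comment> \<open>At least three rows are already present, so 2 * k > 3 * n - b * (b - 1)
        \<ge> 2 * m, which brings k into the range of the lower bound.\<close>
      have "3 * int n \<le> int ((e + 3) * n)" by (simp add: algebra_simps)
      then have "3 * int n < 2 * l" using l3 by linarith
      then have "3 * int n - int ?b * (int ?b - 1) < 2 * k" using ch by (simp add: k_def)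
      moreover have "int ?b * (int ?b - 1) \<le> int (?b * ?b)" by (simp add: algebra_simps)
      moreover have "int m \<ge> int (?b * ?b)" using m(3) by (simp only: of_nat_le_iff)
      moreover have "int n \<ge> int m" using m(1) by linarith
      ultimately have "int m \<le> k" by linarith
      then have 1: "K * 2 ^ (e + 1) * real m ^ (e + 1) \<le> subset_sums_diff n ?b l"
        unfolding s k_def[symmetric] by (rule M[OF m(2) _ k])
      have "?b \<le> m" using m(3) by (meson le_square order_trans)
      then have "real n \<le> 2 * real m" using m(1) by linarith
      then have "K * real n ^ (e + 1) \<le> K * (2 * real m) ^ (e + 1)"
        using K by (intro mult_left_mono power_mono) auto
      then have 2: "K * real n ^ (e + 1) \<le> K * 2 ^ (e + 1) * real m ^ (e + 1)"
        by (simp only: power_mult_distrib mult.assoc)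
      have "\<bar>num_partitions_diff n (e + 3) l\<bar> \<le> K * real n ^ (e + 3 - 2)"
      proof (rule K)
        have "0 \<le> int (?b * n)" by simp
        then show "l \<le> int (?b * n)" using l by linarith
      qed (use n in simp)
      then show "0 \<le> num_partitions_diff n (e + 3) l + subset_sums_diff n ?b l"
        using 1 2 by (simp add: numeral_3_eq_3)
    qed
    then show ?thesis by (simp only: Suc)
  qed
  then show ?thesis by blast
qed

section \<open>At most four rows\<close>

text \<open>
  Multiplying $1/\prod_{i=2}^{b+1}(1-q^i)$ by $1 + q + \cdots + q^b$ cancels the factor $1 - q^{b+1}$
  up to $1 - q$.
\<close>

lemma part_fps_window_sum:
  assumes "b > 0"
  shows "(\<Sum>i=1..Suc b. int_nth (part_fps (Suc b)) (y - int i)) = int_nth (geo_fps (Suc 0) * part_fps b) (y - 1)"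
proof -
  let ?X = "fps_X :: real fps"
  let ?F = "part_fps (Suc b)"
  let ?S = "\<Sum>i<Suc b. ?X ^ i"
  have "(1 - ?X) * ?S = 1 - ?X ^ Suc b"
    by (subst one_diff_power_eq) simp
  then have "(1 - ?X) * (?S * geo_fps (Suc b)) = 1"
    using geo_fps[of "Suc b"] by (simp only: mult.assoc[symmetric])
  then have "geo_fps (Suc 0) = geo_fps (Suc 0) * ((1 - ?X) * (?S * geo_fps (Suc b)))" by simp
  also have "\<dots> = ((1 - ?X) * geo_fps (Suc 0)) * (?S * geo_fps (Suc b))" by (simp only: mult_ac)
  also have "\<dots> = ?S * geo_fps (Suc b)" using geo_fps[of 1] by simp
  finally have "?S * geo_fps (Suc b) = geo_fps (Suc 0)" by simp
  then have S: "?S * ?F = geo_fps (Suc 0) * part_fps b"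
    using assms by (simp only: part_fps_Suc mult.assoc[symmetric])
  have "int_nth (?S * ?F) k = (\<Sum>i<Suc b. int_nth ?F (k - int i))" for k
  proof -
    have "int_nth ((\<Sum>i<n. ?X ^ i) * ?F) k = (\<Sum>i<n. int_nth ?F (k - int i))" for n
      by (induction n) (simp_all add: distrib_right int_nth_add int_nth_X_power_mult, simp add: int_nth_def)
    then show ?thesis .
  qed
  from this[of "y - 1"] have "int_nth (geo_fps (Suc 0) * part_fps b) (y - 1) = (\<Sum>i<Suc b. int_nth ?F (y - int (Suc i)))"
    unfolding S by (simp only: of_nat_Suc diff_diff_eq add.commute)
  also have "\<dots> = (\<Sum>i=1..Suc b. int_nth ?F (y - int i))"
    by (rule sum.reindex_bij_witness[of _ "\<lambda>i. i - 1" Suc]) auto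
  finally show ?thesis by simp
qed

text \<open>The linear numerator terms form a window of b + 1 consecutive coefficients, which
  collapses to one partial sum of the coefficients of \<open>part_fps b\<close>.\<close>

lemma q_binomial_diff_medium:
  assumes "b > 0" "k \<le> 2 * int m + 2"
  shows "q_binomial_diff m (Suc b) k = int_nth (part_fps (Suc b)) k - int_nth (geo_fps (Suc 0) * part_fps b) (k - int m - 1)"
  unfolding q_binomial_diff_def int_nth_top_factors_medium[OF assms(2)] part_fps_window_sum[OF assms(1)] by simp

section \<open>Exact coefficients for three rows\<close>

lemma int_nth_part_fps_3:
  assumes "k \<ge> 0"
  shows "int_nth (part_fps 3) k = of_int (k div 6) + (if k mod 6 = 1 then 0 else 1)"
  using assms
proof (induction "nat k" arbitrary: k rule: less_induct)
  case less
  let ?w = "\<lambda>k::int. if k \<ge> 0 \<and> 2 dvd k then 1 else (0::real)"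
  have step: "int_nth (part_fps 3) k = ?w k + int_nth (part_fps 3) (k - 3)" for k
    using int_nth_geo[of 3 "geo_fps 2" k] part_fps_Suc[of 2] by (simp add: int_nth_geo_one part_fps_2)
  have v: "int_nth (part_fps 3) k = ?w k + ?w (k - 3) + int_nth (part_fps 3) (k - 6)"
    using step[of k] step[of "k - 3"] by simp
  show ?case
  proof (cases "k \<ge> 6")
    case True
    \<comment> \<open>Exactly one of k and k - 3 is even, so six steps add exactly 1.\<close>
    have "?w k + ?w (k - 3) = 1" using True by auto
    then have eq: "int_nth (part_fps 3) k = 1 + int_nth (part_fps 3) (k - 6)" using v by linarith
    have IH: "int_nth (part_fps 3) (k - 6) = of_int ((k - 6) div 6) + (if (k - 6) mod 6 = 1 then 0 else 1)"
      using True by (intro less) simp_all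
    have "(k - 6) div 6 = k div 6 - 1" "(k - 6) mod 6 = k mod 6" by presburger+
    then show ?thesis unfolding eq IH by simp
  next
    case False
    then have "k = 0 \<or> k = 1 \<or> k = 2 \<or> k = 3 \<or> k = 4 \<or> k = 5" using less(2) by presburger
    then show ?thesis using v by (elim disjE) simp_all
  qed
qed

lemma int_nth_geo_1_part_fps_2:
  "int_nth (geo_fps (Suc 0) * part_fps 2) k = (if k < 0 then 0 else of_int (k div 2) + 1)"
proof (induction "nat k" arbitrary: k rule: less_induct)
  case less
  have step: "int_nth (geo_fps (Suc 0) * part_fps 2) k = (if k \<ge> 0 then 1 else 0) + int_nth (geo_fps (Suc 0) * part_fps 2) (k - 2)"
    using int_nth_geo[of 2 "geo_fps (Suc 0)" k] by (simp add: int_nth_geo_one[of "Suc 0"] part_fps_2 mult.commute)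
  have d: "(k - 2) div 2 = k div 2 - 1" by presburger
  consider "k < 0" | "k = 0 \<or> k = 1" | "k \<ge> 2" by linarith
  then show ?case
  proof cases
    case 3
    then show ?thesis using step less[of "k - 2"] d by simp
  qed (use step in auto)
qed

lemma peaked_3:
  assumes "n \<ge> 4"
  shows "peaked n 3"
proof -
  define m where "m = n - 2"
  have m: "n = m + 2" "m \<ge> 2" using assms by (auto simp: m_def)
  have s: "subset_sums_diff n 3 l = q_binomial_diff m 3 (l - 3)" for l
    using subset_sums_diff_eq_q_binomial_diff[of 3 n m l] m by (simp add: choose_two)
  have q: "q_binomial_diff m 3 k = int_nth (part_fps 3) k - int_nth (geo_fps (Suc 0) * part_fps 2) (k - int m - 1)"
    if "2 * k \<le> 3 * int m" for k
    using that m q_binomial_diff_medium[of 2 k m] by (simp add: numeral_3_eq_3 numeral_2_eq_2)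
  have rise: "0 \<le> q_binomial_diff m 3 k" if k: "2 * k \<le> 3 * int m" for k
  proof (cases "k - int m - 1 < 0")
    case True
    then show ?thesis using q[OF k] part_fps_nonneg by (simp add: int_nth_geo_1_part_fps_2)
  next
    case False
    define y where "y = k - int m - 1"
    \<comment> \<open>From 2 * k \<le> 3 * m: the subtracted term, about y / 2, is then at most
      about k / 6.\<close>
    have y: "3 * (y + 1) \<le> k" "0 \<le> y" using False k by (simp_all add: y_def)
    then have "y div 2 + 1 \<le> k div 6 + (if k mod 6 = 1 then 0 else 1)" by presburger
    then have "real_of_int (y div 2 + 1) \<le> real_of_int (k div 6 + (if k mod 6 = 1 then 0 else 1))"
      unfolding of_int_le_iff .
    then have "of_int (y div 2) + 1 \<le> of_int (k div 6) + (if k mod 6 = 1 then 0 else (1::real))"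
      by (simp split: if_splits)
    then show ?thesis
      using q[OF k] y by (simp add: int_nth_geo_1_part_fps_2 int_nth_part_fps_3 flip: y_def)
  qed
  \<comment> \<open>The one-row differences have their only fall, a -1, at l = n + 1, that is at
    index m here.\<close>
  have top: "1 \<le> q_binomial_diff m 3 (int m)"
  proof -
    have "1 \<le> int m div 6 + (if int m mod 6 = 1 then 0 else 1)" using m(2) by presburger
    then have "real_of_int 1 \<le> real_of_int (int m div 6 + (if int m mod 6 = 1 then 0 else 1))"
      unfolding of_int_le_iff .
    then show ?thesis
      using int_nth_part_fps_3[of "int m"] by (simp add: q_binomial_diff_small split: if_splits)
  qed
  have "peaked n (Suc (Suc 1))"
  proof (rule peaked_step[OF peaked_1])
    fix l assume l: "2 * l \<le> int (Suc (Suc 1) * n)"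
    have k: "2 * (l - 3) \<le> 3 * int m" using l m by simp
    have 1: "0 \<le> subset_sums_diff n 3 l" using rise[OF k] by (simp add: s)
    then show "0 \<le> subset_sums_diff n (Suc (Suc 1)) l" by (simp add: numeral_3_eq_3)
    show "0 \<le> num_partitions_diff n 1 l + subset_sums_diff n (Suc (Suc 1)) l"
    proof (cases "l = int n + 1")
      case True
      then have "l - 3 = int m" using m by simp
      then have "1 \<le> subset_sums_diff n 3 l" using top by (simp only: s)
      then show ?thesis
        unfolding num_partitions_diff_1 subset_sums_diff_1 using True by (simp add: numeral_3_eq_3)
    next
      case False
      then show ?thesis
        unfolding num_partitions_diff_1 subset_sums_diff_1 using 1 by (simp add: numeral_3_eq_3)
    qed
  qed
  then show ?thesis by (simp add: numeral_3_eq_3)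
qed

section \<open>Exact coefficients for four rows\<close>

lemma int_nth_geo_1_part_fps_diff:
  "int_nth (geo_fps (Suc 0) * part_fps b) k = int_nth (geo_fps (Suc 0) * part_fps b) (k - 1) + int_nth (part_fps b) k"
  using int_nth_geo[of 1 "part_fps b" k] by simp

lemma int_nth_geo_1_part_mono:
  assumes "j \<le> k"
  shows "int_nth (geo_fps (Suc 0) * part_fps b) j \<le> int_nth (geo_fps (Suc 0) * part_fps b) k"
  using assms
proof (induction k rule: int_ge_induct)
  case (step k)
  then show ?case
    using int_nth_geo_1_part_fps_diff[of b "k + 1"] part_fps_nonneg[of b "k + 1"] by simp
qed simp

lemma int_nth_geo_4_geo_2:
  "int_nth (geo_fps 4 * geo_fps 2) k = (if 2 dvd k then int_nth (geo_fps (Suc 0) * part_fps 2) (k div 2) else 0)"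
proof (induction "nat k" arbitrary: k rule: less_induct)
  case less
  show ?case
  proof (cases "k \<ge> 0")
    case True
    have step: "int_nth (geo_fps 4 * geo_fps 2) k = (if 2 dvd k then 1 else 0) + int_nth (geo_fps 4 * geo_fps 2) (k - 4)"
      using int_nth_geo[of 4 "geo_fps 2" k] True by (simp add: int_nth_geo_one)
    have IH: "int_nth (geo_fps 4 * geo_fps 2) (k - 4) = (if 2 dvd k - 4 then int_nth (geo_fps (Suc 0) * part_fps 2) ((k - 4) div 2) else 0)"
      using less[of "k - 4"] True by (cases "k \<ge> 4") (simp_all add: int_nth_geo_1_part_fps_2)
    have "(2 dvd k - 4) = (2 dvd k)" "(k - 4) div 2 = k div 2 - 2"
      "(k div 2 - 2) div 2 = k div 2 div 2 - 1" by presburger+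
    then show ?thesis
      using True step IH by (auto simp: int_nth_geo_1_part_fps_2)
  qed (simp add: int_nth_geo_1_part_fps_2)
qed

text \<open>In a partition of 2 * j into parts 2, 3, 4 the threes pair up to sixes, and halving
  leaves parts 1, 2, 3. For 2 * j + 1 one three is removed first, leaving 2 * (j - 1).\<close>

lemma int_nth_part_fps_4:
  "int_nth (part_fps 4) (2 * j) = int_nth (geo_fps (Suc 0) * part_fps 3) j \<and>
   int_nth (part_fps 4) (2 * j + 1) = int_nth (geo_fps (Suc 0) * part_fps 3) (j - 1)"
proof (induction "nat j" arbitrary: j rule: less_induct)
  case less
  show ?case
  proof (cases "j \<ge> 0")
    case True
    let ?a = "int_nth (geo_fps 4 * geo_fps 2)"
    let ?q = "int_nth (geo_fps (Suc 0) * part_fps 2)"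
    let ?r = "int_nth (geo_fps (Suc 0) * part_fps 3)"
    have p3: "part_fps 3 = geo_fps 3 * part_fps 2"
      using part_fps_Suc[of 2] by simp
    have p4: "part_fps 4 = geo_fps 3 * (geo_fps 4 * geo_fps 2)"
      using part_fps_Suc[of 3] by (simp add: p3 part_fps_2 mult_ac)
    have r: "geo_fps (Suc 0) * part_fps 3 = geo_fps 3 * (geo_fps (Suc 0) * part_fps 2)"
      by (simp add: p3 mult_ac)
    have rstep: "?r k = ?q k + ?r (k - 3)" for k
      unfolding r using int_nth_geo[of 3 "geo_fps (Suc 0) * part_fps 2" k] by simp
    have step1: "int_nth (part_fps 4) k = ?a k + int_nth (part_fps 4) (k - 3)" for k
      unfolding p4 using int_nth_geo[of 3 "geo_fps 4 * geo_fps 2" k] by simp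
    have step: "int_nth (part_fps 4) k = ?a k + ?a (k - 3) + int_nth (part_fps 4) (k - 6)" for k
      using step1[of k] step1[of "k - 3"] by simp
    have a: "?a (2 * j) = ?q j" "?a (2 * j - 3) = 0" "?a (2 * j + 1) = 0" "?a (2 * j + 1 - 3) = ?q (j - 1)"
    proof -
      have e: "2 * j + 1 - 3 = 2 * (j - 1)" by simp
      show "?a (2 * j + 1 - 3) = ?q (j - 1)" unfolding e int_nth_geo_4_geo_2 by simp
    qed (simp_all add: int_nth_geo_4_geo_2)
    have IH: "int_nth (part_fps 4) (2 * (j - 3)) = ?r (j - 3)" "int_nth (part_fps 4) (2 * (j - 3) + 1) = ?r (j - 3 - 1)"
      using less[of "j - 3"] True by (cases "j = 0"; auto)+
    have e: "2 * (j - 3) = 2 * j - 6" "2 * (j - 3) + 1 = 2 * j + 1 - 6" "j - 3 - 1 = j - 1 - 3" by simp_all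
    show ?thesis
      using step[of "2 * j"] step[of "2 * j + 1"] IH rstep[of j] rstep[of "j - 1"]
      unfolding a e by simp
  next
    case False
    then show ?thesis by simp
  qed
qed

text \<open>Up to the centre, the subtracted partial sum has index at most j - 1. Hence the
  difference is at least the coefficient of \<open>part_fps 3\<close> at j for even indices 2 * j,
  and nonnegative for odd ones; the two-row differences fall only at even l, and only by 1.\<close>

lemma peaked_4:
  assumes "n \<ge> 9"
  shows "peaked n 4"
proof -
  define m where "m = n - 3"
  have m: "n = m + 3" "m \<ge> 6" using assms by (auto simp: m_def)
  let ?r = "int_nth (geo_fps (Suc 0) * part_fps 3)"
  have s: "subset_sums_diff n 4 l = q_binomial_diff m 4 (l - 6)" for l
    using subset_sums_diff_eq_q_binomial_diff[of 4 n m l] m by (simp add: choose_two)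
  have q: "q_binomial_diff m 4 k = int_nth (part_fps 4) k - ?r (k - int m - 1)" if "k \<le> 2 * int m" for k
    using that q_binomial_diff_medium[of 3 k m] by simp
  have even: "int_nth (part_fps 3) j \<le> q_binomial_diff m 4 (2 * j)" if "j \<le> int m" for j
  proof -
    have "?r (2 * j - int m - 1) \<le> ?r (j - 1)"
      using that by (intro int_nth_geo_1_part_mono) simp
    then show ?thesis
      using q[of "2 * j"] that int_nth_part_fps_4[of j] int_nth_geo_1_part_fps_diff[of 3 j] by simp
  qed
  have odd: "0 \<le> q_binomial_diff m 4 (2 * j + 1)" if "2 * j + 1 \<le> 2 * int m" for j
  proof -
    have "?r (2 * j + 1 - int m - 1) \<le> ?r (j - 1)"
      using that by (intro int_nth_geo_1_part_mono) simp
    then show ?thesis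
      using q[of "2 * j + 1"] that int_nth_part_fps_4[of j] by simp
  qed
  \<comment> \<open>In this range the two-row difference is 1 for odd l and 0 for even l, minus the
    coefficient 1 of 1/(1 - q).\<close>
  have low: "num_partitions_diff n 2 l = (if even l then -1 else 0)" if l: "int n < l" "l \<le> 2 * int n" for l
  proof -
    obtain n' where n': "n = Suc n'" using assms by (cases n) auto
    have "subset_sums_diff n 2 l = q_binomial_diff n' 2 (l - 1)"
      using subset_sums_diff_eq_q_binomial_diff[of 2 n n' l] n' by simp
    also have "\<dots> = int_nth (part_fps (Suc 1)) (l - 1) - int_nth (geo_fps (Suc 0) * part_fps 1) (l - 1 - int n' - 1)"
      using q_binomial_diff_medium[of 1 "l - 1" n'] l n' by (simp add: numeral_2_eq_2)
    also have "part_fps 1 = 1" by (simp add: part_fps_def)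
    also have "part_fps (Suc 1) = geo_fps 2" using part_fps_2 by (simp add: numeral_2_eq_2)
    finally have "subset_sums_diff n 2 l = (if even l then -1 else 0)"
      using l n' int_nth_geo_one[of 2 "l - 1"] int_nth_geo_one[of 1 "l - 1 - int n' - 1"] by auto
    moreover have "num_partitions_diff n 2 l = num_partitions_diff n 0 l + subset_sums_diff n 2 l"
      using num_partitions_diff_step[of n 0 l] by (simp add: numeral_2_eq_2)
    ultimately show ?thesis using l assms by (simp add: num_partitions_diff_0)
  qed
  have n0: "n > 0" using assms by simp
  have "peaked n (Suc (Suc 2))"
  proof (rule peaked_step[OF peaked_2[OF n0]])
    fix l assume l: "2 * l \<le> int (Suc (Suc 2) * n)"
    define j where "j = (l - 6) div 2"
    have k: "l - 6 \<le> 2 * int m" using l m by simp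
    have even_l: "subset_sums_diff n 4 l \<ge> int_nth (part_fps 3) j" if "even l"
    proof -
      have "l - 6 = 2 * j" using that by (simp add: j_def)
      then show ?thesis using even[of j] k by (simp add: s)
    qed
    have odd_l: "subset_sums_diff n 4 l \<ge> 0" if "odd l"
    proof -
      have e: "l - 6 = 2 * j + 1" using that unfolding j_def by presburger
      show ?thesis using odd[of j] k unfolding s e by blast
    qed
    have 1: "0 \<le> subset_sums_diff n 4 l"
      using even_l odd_l part_fps_nonneg[of 3 j] by (cases "even l") auto
    then show "0 \<le> subset_sums_diff n (Suc (Suc 2)) l" by simp
    assume l2: "int (2 * n) < 2 * l"
    have low: "num_partitions_diff n 2 l = (if even l then -1 else 0)" using l l2 by (intro low) auto
    show "0 \<le> num_partitions_diff n 2 l + subset_sums_diff n (Suc (Suc 2)) l"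
    proof (cases "even l")
      case True
      \<comment> \<open>An even l > n \<ge> 9 is at least 10; j = 1 has to be avoided since there
        the coefficient of \<open>part_fps 3\<close> is 0.\<close>
      then have "j \<ge> 2" using l2 assms unfolding j_def by presburger
      then have "1 \<le> j div 6 + (if j mod 6 = 1 then 0 else 1)" by presburger
      then have "real_of_int 1 \<le> real_of_int (j div 6 + (if j mod 6 = 1 then 0 else 1))"
        unfolding of_int_le_iff .
      then have "1 \<le> int_nth (part_fps 3) j"
        using int_nth_part_fps_3[of j] \<open>j \<ge> 2\<close> by (simp split: if_splits)
      then show ?thesis using even_l[OF True] low True by simp
    next
      case False
      then show ?thesis using low 1 by simp
    qed
  qed
  then show ?thesis by simp
qed

text \<open>The asymptotic step leads from b - 2 to b for b \<ge> 5, so three and four rows are its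
  starting points.\<close>

lemma eventually_peaked: "\<exists>N. \<forall>n\<ge>N. peaked n b"
proof (induction b rule: less_induct)
  case (less b)
  consider "b = 0" | "b = 1" | "b = 2" | "b = 3" | "b = 4" | "b \<ge> 5" by linarith
  then show ?case
  proof cases
    case 3
    then show ?thesis using peaked_2 by (intro exI[of _ 1]) auto
  next
    case 6
    then obtain e where "b = e + 5" by (metis add.commute le_Suc_ex)
    then show ?thesis using less[of "e + 3"] peaked_large_step[of e] by simp
  qed (use peaked_0 peaked_1 peaked_3 peaked_4 in blast)+
qed

theorem theorem1:
  fixes b :: nat
  assumes "b > 0"
  shows "\<exists>N. \<forall>n\<ge>N. unimodal (rank_gen_poly (truncated_staircase n b))"
  using eventually_peaked[of b] peaked_imp_unimodal by blast

end
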